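(* If $T$ is an nb-bounded linear operator on a sequentially complete locally convex space, then $|\sigma(T)|=r(T)$.
   Context: Spaces are over $\mathbb{C}$; locally convex spaces are Hausdorff by definition. Every base of zero neighborhoods that is mentioned is assumed to consist of balanced sets, to be closed under multiplication by nonzero scalars, and such that for members $V_1,V_2,V$ there are members $W\subseteq V_1\cap V_2$ and $U$ with $U+U\subseteq V$; in a locally convex space its members are also assumed convex. A linear operator is bb-bounded if it maps bounded sets to bounded sets; nn-bounded if there is a base $\mathcal{N}_0$ of zero neighborhoods such that for every $U\in\mathcal{N}_0$ there is $\alpha>0$ with $T(U)\subseteq\alpha U$; nb-bounded if it maps some zero neighborhood into a bounded set. Spectra: $\rho^{bb}(T)$ (resp. $\rho^{c}(T)$, $\rho^{nn}(T)$) is the set of $\lambda\in\mathbb{C}$ such that $\lambda I-T$ has a two-sided inverse that is bb-bounded (resp. continuous, nn-bounded); $\rho^{nb}(T)$ is the set of $\lambda\in\mathbb{C}$ such that $\lambda I-T$ has a two-sided inverse of the form $\alpha I+S$ with $\alpha$ a scalar and $S$ nb-bounded. $\sigma^{bb}(T),\sigma^{c}(T),\sigma^{nn}(T),\sigma^{nb}(T)$ are their complements in $\mathbb{C}$. Spectral radii: $r_{bb}(T)$, $r_c(T)$, $r_{nn}(T)$, $r_{nb}(T)$ are the infima of those $\nu>0$ for which $T^n/\nu^n\to0$, respectively: uniformly on every bounded set; equicontinuously (for every zero neighborhood $V$ there is a zero neighborhood $U$ such that for all $\varepsilon>0$, $\frac{T^n}{\nu^n}(U)\subseteq\varepsilon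 V$ for all large $n$); in the nn-sense (there is a base $\mathcal{N}_0$ of zero neighborhoods such that for every $U\in\mathcal{N}_0$, $\varepsilon>0$: $\frac{T^n}{\nu^n}(U)\subseteq\varepsilon U$ for all large $n$); uniformly on some zero neighborhood. Here $\inf\emptyset=\infty$. For an nb-bounded operator $T$ one has $\sigma^{bb}(T)=\sigma^c(T)=\sigma^{nn}(T)=\sigma^{nb}(T)$ and $r_{bb}(T)=r_c(T)=r_{nn}(T)=r_{nb}(T)$; the common values are denoted $\sigma(T)$ and $r(T)$. Also $|\sigma(T)|=\sup\{|\lambda| : \lambda\in\sigma(T)\}$, with $\sup\emptyset=0$. *)

theory Defs
  imports "HOL-Analysis.Analysis"
begin

text \<open>
  The ground field being the complex numbers, vector spaces are given by the library locale
  \<^locale>\<open>vector_space\<close> with an explicit scalar multiplication \<open>smul :: complex \<Rightarrow> 'a \<Rightarrow> 'a\<close>; the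
  space is the whole type \<open>'a\<close>.  The topology, the continuity of addition and the Hausdorff
  property come from type classes.
\<close>

definition zero_nbhd :: "'a::{zero,topological_space} set \<Rightarrow> bool" where
  "zero_nbhd U \<longleftrightarrow> eventually (\<lambda>x. x \<in> U) (nhds 0)"

definition balanced_set :: "(complex \<Rightarrow> 'a \<Rightarrow> 'a) \<Rightarrow> 'a set \<Rightarrow> bool" where
  "balanced_set smul U \<longleftrightarrow> (\<forall>c x. cmod c \<le> 1 \<longrightarrow> x \<in> U \<longrightarrow> smul c x \<in> U)"

text \<open>The library's \<^const>\<open>convex\<close> presupposes the class \<^class>\<open>real_vector\<close>.\<close>

definition convex_set :: "(complex \<Rightarrow> 'a \<Rightarrow> 'a::plus) \<Rightarrow> 'a set \<Rightarrow> bool" where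
  "convex_set smul U \<longleftrightarrow>
     (\<forall>x\<in>U. \<forall>y\<in>U. \<forall>u v::real. 0 \<le> u \<longrightarrow> 0 \<le> v \<longrightarrow> u + v = 1 \<longrightarrow>
        smul (of_real u) x + smul (of_real v) y \<in> U)"

locale complex_lcs = vector_space smul
  for smul :: "complex \<Rightarrow> 'a::{topological_ab_group_add,t2_space} \<Rightarrow> 'a" +
  assumes continuous_smul: "continuous_on UNIV (\<lambda>(c, x). smul c x)"
    and locally_convex: "zero_nbhd V \<Longrightarrow> \<exists>U. zero_nbhd U \<and> convex_set smul U \<and> U \<subseteq> V"

text \<open>
  Sequential completeness is phrased with the library's \<^const>\<open>Cauchy\<close>, which refers to a
  uniformity.  In the class \<^class>\<open>uniform_topological_group_add\<close> addition and negation are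
  uniformly continuous, so (the group being abelian) the uniformity is the one determined by the
  topology: its entourages are generated by the sets of pairs \<open>(x, y)\<close> with \<open>x - y \<in> U\<close>,
  \<open>U\<close> a zero neighborhood.
\<close>

locale seq_complete_lcs = complex_lcs smul
  for smul :: "complex \<Rightarrow>
    'a::{uniform_topological_group_add,topological_ab_group_add,t2_space} \<Rightarrow> 'a" +
  assumes seq_complete: "Cauchy X \<Longrightarrow> convergent (X :: nat \<Rightarrow> 'a)"

text \<open>
  Bases of zero neighborhoods in a locally convex space, subject to the usual standing
  requirements.  Convexity of the members is built in, as only locally convex spaces are considered.
\<close>

definition zero_base ::
  "(complex \<Rightarrow> 'a \<Rightarrow> 'a::topological_ab_group_add) \<Rightarrow> 'a set set \<Rightarrow> bool" where
  "zero_base smul N \<longleftrightarrow>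
     (\<forall>U\<in>N. zero_nbhd U) \<and>
     (\<forall>V. zero_nbhd V \<longrightarrow> (\<exists>U\<in>N. U \<subseteq> V)) \<and>
     (\<forall>U\<in>N. balanced_set smul U \<and> convex_set smul U) \<and>
     (\<forall>U\<in>N. \<forall>c. c \<noteq> 0 \<longrightarrow> smul c ` U \<in> N) \<and>
     (\<forall>V1\<in>N. \<forall>V2\<in>N. \<exists>W\<in>N. W \<subseteq> V1 \<inter> V2) \<and>
     (\<forall>V\<in>N. \<exists>U\<in>N. {x + y |x y. x \<in> U \<and> y \<in> U} \<subseteq> V)"

definition tvs_bounded ::
  "(complex \<Rightarrow> 'a \<Rightarrow> 'a::topological_ab_group_add) \<Rightarrow> 'a set \<Rightarrow> bool" where
  "tvs_bounded smul B \<longleftrightarrow> (\<forall>U. zero_nbhd U \<longrightarrow> (\<exists>\<alpha>::real. \<alpha> > 0 \<and> B \<subseteq> smul (of_real \<alpha>) ` U))"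


subsection \<open>Bounded operators\<close>

definition bb_bounded ::
  "(complex \<Rightarrow> 'a \<Rightarrow> 'a::topological_ab_group_add) \<Rightarrow> ('a \<Rightarrow> 'a) \<Rightarrow> bool" where
  "bb_bounded smul T \<longleftrightarrow> (\<forall>B. tvs_bounded smul B \<longrightarrow> tvs_bounded smul (T ` B))"

definition nn_bounded ::
  "(complex \<Rightarrow> 'a \<Rightarrow> 'a::topological_ab_group_add) \<Rightarrow> ('a \<Rightarrow> 'a) \<Rightarrow> bool" where
  "nn_bounded smul T \<longleftrightarrow>
     (\<exists>N. zero_base smul N \<and> (\<forall>U\<in>N. \<exists>\<alpha>::real. \<alpha> > 0 \<and> T ` U \<subseteq> smul (of_real \<alpha>) ` U))"

definition nb_bounded ::
  "(complex \<Rightarrow> 'a \<Rightarrow> 'a::topological_ab_group_add) \<Rightarrow> ('a \<Rightarrow> 'a) \<Rightarrow> bool" where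
  "nb_bounded smul T \<longleftrightarrow> (\<exists>U. zero_nbhd U \<and> tvs_bounded smul (T ` U))"


subsection \<open>Spectra\<close>

definition resolvent_set ::
  "(complex \<Rightarrow> 'a \<Rightarrow> 'a::topological_ab_group_add) \<Rightarrow> (('a \<Rightarrow> 'a) \<Rightarrow> bool) \<Rightarrow> ('a \<Rightarrow> 'a) \<Rightarrow> complex set"
where
  "resolvent_set smul P T =
     {\<mu>. \<exists>R. Vector_Spaces.linear smul smul R \<and> P R \<and>
          R \<circ> (\<lambda>x. smul \<mu> x - T x) = id \<and> (\<lambda>x. smul \<mu> x - T x) \<circ> R = id}"

definition spectrum_bb ::
  "(complex \<Rightarrow> 'a \<Rightarrow> 'a::topological_ab_group_add) \<Rightarrow> ('a \<Rightarrow> 'a) \<Rightarrow> complex set" where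
  "spectrum_bb smul T = - resolvent_set smul (bb_bounded smul) T"

definition spectrum_c ::
  "(complex \<Rightarrow> 'a \<Rightarrow> 'a::topological_ab_group_add) \<Rightarrow> ('a \<Rightarrow> 'a) \<Rightarrow> complex set" where
  "spectrum_c smul T = - resolvent_set smul (continuous_on UNIV) T"

definition spectrum_nn ::
  "(complex \<Rightarrow> 'a \<Rightarrow> 'a::topological_ab_group_add) \<Rightarrow> ('a \<Rightarrow> 'a) \<Rightarrow> complex set" where
  "spectrum_nn smul T = - resolvent_set smul (nn_bounded smul) T"

definition spectrum_nb ::
  "(complex \<Rightarrow> 'a \<Rightarrow> 'a::topological_ab_group_add) \<Rightarrow> ('a \<Rightarrow> 'a) \<Rightarrow> complex set" where
  "spectrum_nb smul T =
     - resolvent_set smul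
         (\<lambda>R. \<exists>\<alpha> S. Vector_Spaces.linear smul smul S \<and> nb_bounded smul S \<and>
                     R = (\<lambda>x. smul \<alpha> x + S x)) T"

text \<open>In \<^typ>\<open>ennreal\<close> the supremum of the empty set is \<open>0\<close>.\<close>

definition spectrum_modulus :: "complex set \<Rightarrow> ennreal" where
  "spectrum_modulus \<sigma> = (SUP \<mu>\<in>\<sigma>. ennreal (cmod \<mu>))"


subsection \<open>Spectral radii\<close>

text \<open>Modes of convergence to zero of a sequence of operators.\<close>

definition uniformly_null_on ::
  "'a::topological_ab_group_add set \<Rightarrow> (nat \<Rightarrow> 'a \<Rightarrow> 'a) \<Rightarrow> bool" where
  "uniformly_null_on A S \<longleftrightarrow> (\<forall>V. zero_nbhd V \<longrightarrow> (\<forall>\<^sub>F n in sequentially. S n ` A \<subseteq> V))"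

definition bb_null ::
  "(complex \<Rightarrow> 'a \<Rightarrow> 'a::topological_ab_group_add) \<Rightarrow> (nat \<Rightarrow> 'a \<Rightarrow> 'a) \<Rightarrow> bool" where
  "bb_null smul S \<longleftrightarrow> (\<forall>B. tvs_bounded smul B \<longrightarrow> uniformly_null_on B S)"

definition equicontinuously_null ::
  "(complex \<Rightarrow> 'a \<Rightarrow> 'a::topological_ab_group_add) \<Rightarrow> (nat \<Rightarrow> 'a \<Rightarrow> 'a) \<Rightarrow> bool" where
  "equicontinuously_null smul S \<longleftrightarrow>
     (\<forall>V. zero_nbhd V \<longrightarrow> (\<exists>U. zero_nbhd U \<and>
        (\<forall>\<epsilon>::real. \<epsilon> > 0 \<longrightarrow> (\<forall>\<^sub>F n in sequentially. S n ` U \<subseteq> smul (of_real \<epsilon>) ` V))))"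

definition nn_null ::
  "(complex \<Rightarrow> 'a \<Rightarrow> 'a::topological_ab_group_add) \<Rightarrow> (nat \<Rightarrow> 'a \<Rightarrow> 'a) \<Rightarrow> bool" where
  "nn_null smul S \<longleftrightarrow>
     (\<exists>N. zero_base smul N \<and>
        (\<forall>U\<in>N. \<forall>\<epsilon>::real. \<epsilon> > 0 \<longrightarrow> (\<forall>\<^sub>F n in sequentially. S n ` U \<subseteq> smul (of_real \<epsilon>) ` U)))"

definition nb_null :: "(nat \<Rightarrow> 'a::topological_ab_group_add \<Rightarrow> 'a) \<Rightarrow> bool" where
  "nb_null S \<longleftrightarrow> (\<exists>U. zero_nbhd U \<and> uniformly_null_on U S)"

text \<open>The infimum is taken in \<^typ>\<open>ennreal\<close>, so that it is infinite when no \<open>\<nu>\<close> qualifies.\<close>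

definition radius_wrt ::
  "(complex \<Rightarrow> 'a \<Rightarrow> 'a::topological_ab_group_add) \<Rightarrow> ((nat \<Rightarrow> 'a \<Rightarrow> 'a) \<Rightarrow> bool) \<Rightarrow> ('a \<Rightarrow> 'a) \<Rightarrow> ennreal"
where
  "radius_wrt smul null T =
     Inf {ennreal \<nu> |\<nu>. \<nu> > 0 \<and> null (\<lambda>n x. smul (of_real (1 / \<nu> ^ n)) ((T ^^ n) x))}"

definition radius_bb ::
  "(complex \<Rightarrow> 'a \<Rightarrow> 'a::topological_ab_group_add) \<Rightarrow> ('a \<Rightarrow> 'a) \<Rightarrow> ennreal" where
  "radius_bb smul T = radius_wrt smul (bb_null smul) T"

definition radius_c ::
  "(complex \<Rightarrow> 'a \<Rightarrow> 'a::topological_ab_group_add) \<Rightarrow> ('a \<Rightarrow> 'a) \<Rightarrow> ennreal" where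
  "radius_c smul T = radius_wrt smul (equicontinuously_null smul) T"

definition radius_nn ::
  "(complex \<Rightarrow> 'a \<Rightarrow> 'a::topological_ab_group_add) \<Rightarrow> ('a \<Rightarrow> 'a) \<Rightarrow> ennreal" where
  "radius_nn smul T = radius_wrt smul (nn_null smul) T"

definition radius_nb ::
  "(complex \<Rightarrow> 'a \<Rightarrow> 'a::topological_ab_group_add) \<Rightarrow> ('a \<Rightarrow> 'a) \<Rightarrow> ennreal" where
  "radius_nb smul T = radius_wrt smul nb_null T"

end

theory Submission
  imports Defs
begin

text \<open>
  The topology is handled through continuous seminorms.  Fix a seminorm \<open>p\<close> for which every continuous
  seminorm of \<open>T x\<close> is at most a multiple of \<open>p x\<close>; it lets \<open>T\<close> and its resolvents be
  treated like bounded operators on a normed space.  An inverse \<open>R\<close> of \<open>\<mu> - T\<close> with \<open>\<mu> \<noteq> 0\<close> equals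
  \<open>\<mu>\<^sup>-\<^sup>1 (1 + R T)\<close>, so all four spectra agree away from \<open>0\<close>, and \<open>T\<^sup>n = T\<^sup>n\<^sup>-\<^sup>1 T\<close> makes the four radii
  agree.  The Neumann series, which converges by sequential completeness, shows that the spectral
  radius bounds the spectrum.

  The converse uses no complex analysis.  If \<open>A z = (1 - z T)\<^sup>-\<^sup>1\<close> exists for \<open>\<bar>z\<bar> \<le> r\<close>, it is
  Lipschitz in \<open>z\<close> with respect to \<open>p\<close>, hence so are the averages
  \<open>(1 - (t T)\<^sup>n)\<^sup>-\<^sup>1 = (1/n) \<Sum>\<^sub>\<omega> A (t \<omega>)\<close> over the \<open>n\<close>-th roots of unity, with the same constant for
  all \<open>n\<close>.  Therefore \<open>(s T)\<^sup>n \<rightarrow> 0\<close> propagates from \<open>s\<close> to \<open>s + d\<close> with a fixed step \<open>d > 0\<close>, and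
  so from \<open>0\<close> to every \<open>t < r\<close>.
\<close>

section \<open>Seminorms and zero neighborhoods\<close>

locale complex_seminorm = vector_space smul
  for smul :: "complex \<Rightarrow> 'a::ab_group_add \<Rightarrow> 'a" +
  fixes p :: "'a \<Rightarrow> real"
  assumes triangle: "p (x + y) \<le> p x + p y"
    and homogeneous: "p (smul c x) = cmod c * p x"
begin

lemma at_zero [simp]: "p 0 = 0"
  using homogeneous[of 0 0] by simp

lemma at_minus [simp]: "p (- x) = p x"
  using homogeneous[of "-1" x] by simp

lemma nonneg [simp]: "0 \<le> p x"
  using triangle[of x "- x"] by simp

lemma diff_le: "p (x - y) \<le> p x + p y"
  using triangle[of x "- y"] by simp

lemma sum_le: "p (sum f A) \<le> (\<Sum>i\<in>A. p (f i))"
proof (induction A rule: infinite_finite_induct)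
  case (insert a A)
  then show ?case
    using triangle[of "f a" "sum f A"] by simp
qed auto

text \<open>The added \<open>e\<close> lets \<open>x\<close> be rescaled into the open unit ball even when \<open>p x = 0\<close>.\<close>

lemma scaled_into_ball:
  assumes "0 < e"
  obtains y where "x = smul (of_real (p x + e)) y" "p y < 1"
proof
  have "0 < p x + e"
    using assms by (simp add: add_nonneg_pos)
  then have "complex_of_real (p x + e) \<noteq> 0"
    using of_real_eq_0_iff by (metis less_irrefl)
  then show "x = smul (of_real (p x + e)) (smul (of_real (1 / (p x + e))) x)"
    by (simp flip: of_real_mult)
  show "p (smul (of_real (1 / (p x + e))) x) < 1"
    using \<open>0 < p x + e\<close> assms unfolding homogeneous norm_of_real by (simp add: field_simps)
qed

text \<open>The bridge from inclusions between scaled sets, in which boundedness is defined, to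
  inequalities between seminorms.\<close>

lemma scaled_ball:
  assumes "c \<noteq> 0"
  shows "smul c ` {x. p x < r} = {x. p x < cmod c * r}"
proof (intro equalityI subsetI)
  fix x assume "x \<in> {x. p x < cmod c * r}"
  then have "smul (1 / c) x \<in> {x. p x < r}" "x = smul c (smul (1 / c) x)"
    using assms by (simp_all add: homogeneous norm_divide field_simps)
  then show "x \<in> smul c ` {x. p x < r}"
    by blast
qed (use assms in \<open>auto simp: homogeneous\<close>)

lemma balanced_ball: "balanced_set smul {x. p x < r}"
  unfolding balanced_set_def
proof (intro allI impI)
  fix c x assume "cmod c \<le> 1" "x \<in> {x. p x < r}"
  then have "cmod c * p x \<le> 1 * p x" "p x < r"
    using mult_right_mono[of "cmod c" 1 "p x"] by simp_all
  then show "smul c x \<in> {x. p x < r}"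
    by (simp add: homogeneous)
qed

end

lemma complex_seminorm_max:
  assumes "complex_seminorm smul p" "complex_seminorm smul q"
  shows "complex_seminorm smul (\<lambda>x. max (p x) (q x))"
proof -
  interpret p: complex_seminorm smul p by fact
  interpret q: complex_seminorm smul q by fact
  show ?thesis
  proof
    fix x y
    show "max (p (x + y)) (q (x + y)) \<le> max (p x) (q x) + max (p y) (q y)"
      using p.triangle[of x y] q.triangle[of x y] by linarith
  qed (simp add: p.homogeneous q.homogeneous max_mult_distrib_left)
qed

lemma complex_seminorm_scale:
  assumes "complex_seminorm smul p" "0 \<le> r"
  shows "complex_seminorm smul (\<lambda>x. r * p x)"
proof -
  interpret p: complex_seminorm smul p by fact
  show ?thesis
  proof
    show "r * p (x + y) \<le> r * p x + r * p y" for x y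
      using mult_left_mono[OF p.triangle[of x y] \<open>0 \<le> r\<close>] by (simp add: distrib_left)
  qed (simp add: p.homogeneous)
qed

section \<open>Zero neighborhoods and continuity at zero\<close>

lemma zero_nbhd_mono: "zero_nbhd U \<Longrightarrow> U \<subseteq> V \<Longrightarrow> zero_nbhd V"
  unfolding zero_nbhd_def by (auto elim: eventually_mono)

lemma zero_nbhd_Int: "zero_nbhd U \<Longrightarrow> zero_nbhd V \<Longrightarrow> zero_nbhd (U \<inter> V)"
  unfolding zero_nbhd_def by (auto elim: eventually_elim2)

lemma continuous_on_UNIV_tendsto_nhds:
  fixes f :: "'a::t2_space \<Rightarrow> 'b::topological_space"
  assumes "continuous_on UNIV f"
  shows "(f \<longlongrightarrow> f a) (nhds a)"
  using assms continuous_on_eq_continuous_at[OF open_UNIV, of f] tendsto_at_iff_tendsto_nhds[of f a]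
  by (simp add: isCont_def)

text \<open>Translation: \<open>f x = f (x - a) + f a\<close> carries continuity at \<open>0\<close>
  to every point \<open>a\<close>.\<close>

lemma continuous_on_UNIV_iff_at_zero:
  fixes f :: "'a::{topological_ab_group_add,t2_space} \<Rightarrow> 'a"
  assumes "\<And>x y. f (x + y) = f x + f y"
  shows "continuous_on UNIV f \<longleftrightarrow> (f \<longlongrightarrow> 0) (nhds 0)"
proof -
  have 0: "f 0 = 0"
    using assms[of 0 0] by simp
  have *: "filterlim (\<lambda>x. x - a) (nhds 0) (nhds a)" for a :: 'a
    using tendsto_diff[OF filterlim_ident[of "nhds a"] tendsto_const[of a]] by simp
  show ?thesis
  proof
    assume "continuous_on UNIV f"
    then show "(f \<longlongrightarrow> 0) (nhds 0)"
      using continuous_on_UNIV_tendsto_nhds[of f 0] 0 by simp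
  next
    assume lim: "(f \<longlongrightarrow> 0) (nhds 0)"
    have "isCont f a" for a
    proof -
      have "((\<lambda>x. f (x - a) + f a) \<longlongrightarrow> 0 + f a) (nhds a)"
        by (intro tendsto_add tendsto_const filterlim_compose[OF lim *])
      moreover have "f (x - a) + f a = f x" for x
        using assms[of "x - a" a] by simp
      ultimately have "filterlim f (nhds (f a)) (nhds a)"
        by simp
      then show "isCont f a"
        by (simp add: isCont_def tendsto_at_iff_tendsto_nhds)
    qed
    then show "continuous_on UNIV f"
      by (simp add: continuous_at_imp_continuous_on)
  qed
qed

section \<open>Balanced convex neighborhoods, continuous seminorms and gauges\<close>

context complex_lcs
begin

lemma continuous_on_smul_left: "continuous_on UNIV (\<lambda>x. smul c x)"
  using continuous_on_compose2[OF continuous_smul, of UNIV "\<lambda>x. (c, x)"]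
  by (simp add: continuous_on_Pair)

lemma continuous_on_smul_right: "continuous_on UNIV (\<lambda>c. smul c x)"
  using continuous_on_compose2[OF continuous_smul, of UNIV "\<lambda>c. (c, x)"]
  by (simp add: continuous_on_Pair)

lemma zero_nbhd_scale:
  assumes "zero_nbhd U" "c \<noteq> 0"
  shows "zero_nbhd (smul c ` U)"
proof -
  have "((\<lambda>x. smul (1 / c) x) \<longlongrightarrow> 0) (nhds 0)"
    using continuous_on_smul_left continuous_on_UNIV_iff_at_zero[of "\<lambda>x. smul (1 / c) x"]
    by (simp add: scale_right_distrib)
  then have "eventually (\<lambda>x. smul (1 / c) x \<in> U) (nhds 0)"
    using assms(1) unfolding zero_nbhd_def filterlim_iff by blast
  then show ?thesis
    unfolding zero_nbhd_def
  proof eventually_elim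
    case (elim x)
    then show ?case
      using assms(2) by (intro image_eqI[of _ _ "smul (1 / c) x"]) simp_all
  qed
qed

lemma zero_nbhd_absorbing:
  assumes "zero_nbhd U"
  obtains r :: real where "0 < r" "smul (of_real r) x \<in> U"
proof -
  have "((\<lambda>c. smul c x) \<longlongrightarrow> 0) (nhds 0)"
    using continuous_on_UNIV_tendsto_nhds[OF continuous_on_smul_right, of x 0] by simp
  then have "eventually (\<lambda>c. smul c x \<in> U) (nhds 0)"
    using assms unfolding zero_nbhd_def filterlim_iff by blast
  then obtain d where "0 < d" "\<And>c. dist c 0 < d \<Longrightarrow> smul c x \<in> U"
    unfolding eventually_nhds_metric by blast
  then show thesis
    using that[of "d / 2"] by simp
qed

text \<open>The set of all \<open>x\<close> whose unit disc multiples stay in a convex zero neighborhood is convex,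
  balanced, and still a zero neighborhood, by continuity of the scalar multiplication at
  \<open>(0, 0)\<close>.\<close>

lemma balanced_convex_nbhd:
  assumes "zero_nbhd V"
  obtains B where "zero_nbhd B" "B \<subseteq> V" "balanced_set smul B" "convex_set smul B"
proof -
  obtain W where W: "zero_nbhd W" "convex_set smul W" "W \<subseteq> V"
    using locally_convex[OF assms] by blast
  define B where "B = {x. \<forall>c. cmod c \<le> 1 \<longrightarrow> smul c x \<in> W}"
  have "((\<lambda>(c, x). smul c x) \<longlongrightarrow> 0) (nhds 0 \<times>\<^sub>F nhds 0)"
    using continuous_on_UNIV_tendsto_nhds[OF continuous_smul, of "(0, 0)"] by (simp add: nhds_prod)
  then have "eventually (\<lambda>z. (\<lambda>(c, x). smul c x) z \<in> W) (nhds 0 \<times>\<^sub>F nhds 0)"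
    using W(1) unfolding zero_nbhd_def filterlim_iff by blast
  then obtain P Q where PQ: "eventually P (nhds (0::complex))" "eventually Q (nhds (0::'a))"
    "\<And>c x. P c \<Longrightarrow> Q x \<Longrightarrow> smul c x \<in> W"
    unfolding eventually_prod_filter by auto
  obtain d where d: "0 < d" "\<And>c. dist c 0 < d \<Longrightarrow> P c"
    using PQ(1) unfolding eventually_nhds_metric by blast
  \<comment> \<open>If \<open>cmod c \<le> 1\<close>, then \<open>c\<close> times
    \<open>d / 2\<close> has modulus below \<open>d\<close>, so all unit disc multiples of this
    scaled set stay in \<open>W\<close>.\<close>
  have "zero_nbhd (smul (of_real (d / 2)) ` {x. Q x})"
    using PQ(2) d(1) by (intro zero_nbhd_scale) (auto simp: zero_nbhd_def)
  moreover have "smul (of_real (d / 2)) ` {x. Q x} \<subseteq> B"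
  proof
    fix y assume "y \<in> smul (of_real (d / 2)) ` {x. Q x}"
    then obtain x where x: "Q x" "y = smul (of_real (d / 2)) x"
      by blast
    have "smul c y \<in> W" if "cmod c \<le> 1" for c
    proof -
      have "cmod c * (d / 2) \<le> 1 * (d / 2)"
        using that d(1) by (intro mult_right_mono) auto
      then have "dist (c * of_real (d / 2)) 0 < d"
        using d(1) by (simp add: norm_mult norm_divide)
      then show ?thesis
        using PQ(3) d(2) x by simp
    qed
    then show "y \<in> B"
      by (simp add: B_def)
  qed
  ultimately have "zero_nbhd B"
    by (rule zero_nbhd_mono)
  moreover have "B \<subseteq> V"
  proof
    fix x assume "x \<in> B"
    then have "smul 1 x \<in> W"
      by (simp add: B_def del: scale_one)
    then show "x \<in> V"
      using W(3) by auto
  qed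
  moreover have "balanced_set smul B"
    unfolding balanced_set_def B_def
    by (auto simp: norm_mult mult_le_one)
  moreover have "convex_set smul B"
    using W(2) unfolding convex_set_def B_def
    by (auto simp: scale_right_distrib scale_left_commute[of _ "of_real _"] simp del: scale_scale)
  ultimately show thesis
    using that by blast
qed

text \<open>Asking that the unit ball be a zero neighborhood suffices: homogeneity and the triangle
  inequality then give continuity everywhere.\<close>

definition continuous_seminorm :: "('a \<Rightarrow> real) \<Rightarrow> bool" where
  "continuous_seminorm p \<longleftrightarrow> complex_seminorm smul p \<and> zero_nbhd {x. p x < 1}"

lemma continuous_seminormD: "continuous_seminorm p \<Longrightarrow> complex_seminorm smul p"
  by (simp add: continuous_seminorm_def)

lemma zero_nbhd_ball:
  assumes "continuous_seminorm p" "0 < r"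
  shows "zero_nbhd {x. p x < r}"
proof -
  interpret complex_seminorm smul p
    using assms(1) by (rule continuous_seminormD)
  have "zero_nbhd (smul (of_real r) ` {x. p x < 1})"
    using assms by (intro zero_nbhd_scale) (auto simp: continuous_seminorm_def)
  then show ?thesis
    using assms(2) by (subst (asm) scaled_ball) auto
qed

lemma continuous_seminorm_max:
  assumes "continuous_seminorm p" "continuous_seminorm q"
  shows "continuous_seminorm (\<lambda>x. max (p x) (q x))"
proof -
  have "{x. max (p x) (q x) < 1} = {x. p x < 1} \<inter> {x. q x < 1}"
    by auto
  then show ?thesis
    using assms complex_seminorm_max zero_nbhd_Int by (auto simp: continuous_seminorm_def)
qed

lemma continuous_seminorm_scale:
  assumes "continuous_seminorm p" "0 < r"
  shows "continuous_seminorm (\<lambda>x. r * p x)"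
proof -
  have "{x. r * p x < 1} = {x. p x < 1 / r}"
    using assms(2) by (auto simp: field_simps)
  then show ?thesis
    using assms zero_nbhd_ball[OF assms(1), of "1 / r"] complex_seminorm_scale[of smul p r]
    by (simp add: continuous_seminorm_def)
qed

text \<open>The seminorm is the gauge of a balanced convex zero neighborhood inside \<open>V\<close>.\<close>

lemma continuous_seminorm_in_nbhd:
  assumes "zero_nbhd V"
  obtains p where "continuous_seminorm p" "{x. p x < 1} \<subseteq> V"
proof -
  obtain B where B: "zero_nbhd B" "B \<subseteq> V" "balanced_set smul B" "convex_set smul B"
    using balanced_convex_nbhd[OF assms] .
  define G where "G x = {r::real. 0 < r \<and> smul (of_real (1 / r)) x \<in> B}" for x
  define p where "p x = Inf (G x)" for x
  have bdd: "bdd_below (G x)" for x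
    by (auto simp: G_def intro!: bdd_belowI[of _ 0])
  have G_nonempty: "G x \<noteq> {}" for x
  proof -
    obtain r where "0 < r" "smul (of_real r) x \<in> B"
      using zero_nbhd_absorbing[OF B(1)] .
    then have "1 / r \<in> G x"
      by (simp add: G_def)
    then show ?thesis by blast
  qed
  have p_le: "p x \<le> r" if "r \<in> G x" for x r
    unfolding p_def using that bdd by (rule cInf_lower)
  have p_nonneg: "0 \<le> p x" for x
    unfolding p_def using G_nonempty by (rule cInf_greatest) (auto simp: G_def)
  \<comment> \<open>Some \<open>s\<close> in \<open>G x\<close> lies below \<open>r\<close> by the
    definition of the infimum, and balancedness of \<open>B\<close> passes from \<open>s\<close> to
    the larger \<open>r\<close>.\<close>
  have in_G: "r \<in> G x" if less: "p x < r" for x r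
  proof -
    obtain s where s: "s \<in> G x" "s < r"
      using cInf_lessD[OF G_nonempty[of x], of r] less by (auto simp: p_def)
    then have "0 < s"
      by (simp add: G_def)
    have "smul (of_real (s / r)) (smul (of_real (1 / s)) x) \<in> B"
      using s \<open>0 < s\<close> B(3) unfolding balanced_set_def G_def
      by (auto simp del: scale_scale simp add: norm_divide)
    then show ?thesis
      using s \<open>0 < s\<close> by (simp add: G_def)
  qed
  have sub: "p (x + y) \<le> p x + p y" for x y
  proof (rule field_le_epsilon)
    fix e :: real assume "0 < e"
    define r s where "r = p x + e / 2" and "s = p y + e / 2"
    have rs: "0 < r" "0 < s" "r \<in> G x" "s \<in> G y"
      using \<open>0 < e\<close> p_nonneg[of x] p_nonneg[of y] in_G by (auto simp: r_def s_def)
    \<comment> \<open>With these weights \<open>(x + y) / (r + s)\<close> is a convex combination of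
      \<open>x / r\<close> and \<open>y / s\<close>.\<close>
    have "r / (r + s) + s / (r + s) = 1"
      using rs by (simp flip: add_divide_distrib)
    then have "smul (of_real (r / (r + s))) (smul (of_real (1 / r)) x)
        + smul (of_real (s / (r + s))) (smul (of_real (1 / s)) y) \<in> B"
      using rs B(4) unfolding convex_set_def G_def by (auto simp del: scale_scale of_real_divide)
    then have "r + s \<in> G (x + y)"
      using rs by (simp add: G_def scale_right_distrib)
    then show "p (x + y) \<le> p x + p y + e"
      using p_le[of "r + s" "x + y"] by (simp add: r_def s_def)
  qed
  have le_homog: "p (smul c x) \<le> cmod c * p x" if "c \<noteq> 0" for c x
  proof (rule field_le_epsilon)
    fix e :: real assume "0 < e"
    define r where "r = p x + e / cmod c"
    have r: "0 < r" "r \<in> G x"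
      using \<open>0 < e\<close> p_nonneg[of x] in_G \<open>c \<noteq> 0\<close> by (auto simp: r_def add_nonneg_pos)
    \<comment> \<open>The phase of \<open>c\<close> has modulus one, and balancedness absorbs
      it.\<close>
    have "smul (c / of_real (cmod c)) (smul (of_real (1 / r)) x) \<in> B"
      using r B(3) \<open>c \<noteq> 0\<close> unfolding balanced_set_def G_def
      by (auto simp del: scale_scale simp add: norm_divide)
    then have "cmod c * r \<in> G (smul c x)"
      using r \<open>c \<noteq> 0\<close> by (simp add: G_def)
    then have "p (smul c x) \<le> cmod c * r"
      by (rule p_le)
    then show "p (smul c x) \<le> cmod c * p x + e"
      using \<open>c \<noteq> 0\<close> by (simp add: r_def distrib_left)
  qed
  have homog: "p (smul c x) = cmod c * p x" for c x
  proof (cases "c = 0")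
    case True
    have "p 0 \<le> e" if "0 < e" for e
    proof (rule p_le)
      obtain r where "0 < r" "smul (of_real r) 0 \<in> B"
        using zero_nbhd_absorbing[OF B(1)] .
      then show "e \<in> G 0"
        using that by (simp add: G_def)
    qed
    then have "p 0 \<le> 0"
      using field_le_epsilon[of "p 0" 0] by simp
    then show ?thesis
      using True p_nonneg[of 0] by simp
  next
    case False
    then have "p (smul (1 / c) (smul c x)) \<le> cmod (1 / c) * p (smul c x)"
      by (intro le_homog) simp
    then have "cmod c * p x \<le> p (smul c x)"
      using False by (simp add: norm_divide field_simps)
    then show ?thesis
      using le_homog[OF False, of x] by simp
  qed
  have "complex_seminorm smul p"
    by unfold_locales (fact sub, fact homog)
  \<comment> \<open>On \<open>B\<close> itself only \<open>p x \<le> 1\<close> is guaranteed;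
    halving makes the inequality strict.\<close>
  moreover have "smul (1 / 2) ` B \<subseteq> {x. p x < 1}"
  proof
    fix y assume "y \<in> smul (1 / 2) ` B"
    then have "1 / 2 \<in> G y"
      by (auto simp: G_def)
    then show "y \<in> {x. p x < 1}"
      using p_le by force
  qed
  then have "zero_nbhd {x. p x < 1}"
    using zero_nbhd_scale[OF B(1), of "1 / 2"] zero_nbhd_mono by simp
  moreover have "{x. p x < 1} \<subseteq> V"
    using in_G[of _ 1] B(2) by (auto simp: G_def)
  ultimately show thesis
    using that by (auto simp: continuous_seminorm_def)
qed

end

section \<open>Decay of powers inside the disc of invertibility\<close>

text \<open>\<open>A z\<close> plays the role of \<open>(1 - z T)\<^sup>-\<^sup>1\<close>.\<close>

locale bounded_resolvent = complex_seminorm smul p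
  for smul :: "complex \<Rightarrow> 'a::ab_group_add \<Rightarrow> 'a" and p :: "'a \<Rightarrow> real" +
  fixes T :: "'a \<Rightarrow> 'a" and A :: "complex \<Rightarrow> 'a \<Rightarrow> 'a" and a r :: real
  assumes linear_T: "Vector_Spaces.linear smul smul T"
    and T_le: "p (T x) \<le> a * p x"
    and radius_pos: "0 < r"
    and linear_A: "cmod z \<le> r \<Longrightarrow> Vector_Spaces.linear smul smul (A z)"
    and left_inverse: "cmod z \<le> r \<Longrightarrow> A z (x - smul z (T x)) = x"
    and right_inverse: "cmod z \<le> r \<Longrightarrow> A z x - smul z (T (A z x)) = x"
    and A_bounded: "cmod z \<le> r \<Longrightarrow> \<exists>K. \<forall>x. p (A z x) \<le> K * p x"
begin

section \<open>Bounds for \<open>A z\<close> on the closed disc\<close>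

sublocale T: Vector_Spaces.linear smul smul T
  by (rule linear_T)

text \<open>With \<open>y = A w x\<close>, the vector \<open>x = y - w T y\<close> splits as
  \<open>(y - z T y) + (z - w) T y\<close>; apply \<open>A z\<close>.\<close>

lemma resolvent_identity:
  assumes "cmod z \<le> r" "cmod w \<le> r"
  shows "A z x - A w x = smul (z - w) (A z (T (A w x)))"
proof -
  interpret Az: Vector_Spaces.linear smul smul "A z"
    by (rule linear_A) fact
  define y where "y = A w x"
  have "x = (y - smul z (T y)) + smul (z - w) (T y)"
    using right_inverse[OF assms(2), of x] by (simp add: y_def scale_left_diff_distrib)
  then have "A z x = A z (y - smul z (T y)) + A z (smul (z - w) (T y))"
    by (metis Az.add)
  then show ?thesis
    by (simp add: left_inverse assms Az.scale y_def)
qed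

text \<open>The sign of \<open>a\<close> is unknown; \<open>\<bar>a\<bar> + 1\<close> is positive
  and can be divided by.\<close>

lemma T_le_abs: "p (T x) \<le> (\<bar>a\<bar> + 1) * p x"
  by (rule order_trans[OF T_le]) (intro mult_right_mono; simp)

text \<open>In the resolvent identity \<open>A z\<close> occurs on both sides. For \<open>z\<close>
  near \<open>w\<close> its term on the right carries a factor of at most \<open>1 / 2\<close> and
  is absorbed on the left.\<close>

lemma A_bounded_nearby:
  assumes "cmod w \<le> r"
  obtains d K where "0 < d" "0 < K" "\<And>z x. cmod z \<le> r \<Longrightarrow> dist w z < d \<Longrightarrow> p (A z x) \<le> K * p x"
proof -
  obtain K0 where K0: "\<And>x. p (A w x) \<le> K0 * p x"
    using A_bounded[OF assms] by blast
  define K where "K = max 1 K0"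
  have K: "0 < K" "p (A w x) \<le> K * p x" for x
    using order_trans[OF K0[of x] mult_right_mono[of K0 K "p x"]] by (auto simp: K_def)
  define d where "d = 1 / (2 * K * (\<bar>a\<bar> + 1))"
  have "\<bar>a\<bar> + 1 \<noteq> 0"
    by arith
  then have d: "0 < d" "d * (K * (\<bar>a\<bar> + 1)) = 1 / 2"
    using K(1) by (simp_all add: d_def)
  have "p (A z x) \<le> 2 * K * p x" if z: "cmod z \<le> r" "dist w z < d" for z x
  proof -
    have "A z x = A w x - smul (w - z) (A w (T (A z x)))"
      using resolvent_identity[OF assms z(1), of x] by (simp add: algebra_simps)
    then have "p (A z x) \<le> p (A w x) + p (smul (w - z) (A w (T (A z x))))"
      by (metis diff_le)
    also have "\<dots> = p (A w x) + dist w z * p (A w (T (A z x)))"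
      by (simp add: homogeneous dist_norm)
    also have "\<dots> \<le> K * p x + d * (K * ((\<bar>a\<bar> + 1) * p (A z x)))"
    proof (intro add_mono mult_mono K)
      show "p (A w (T (A z x))) \<le> K * ((\<bar>a\<bar> + 1) * p (A z x))"
        using order_trans[OF K(2) mult_left_mono[OF T_le_abs]] K(1) by simp
    qed (use z d in auto)
    also have "d * (K * ((\<bar>a\<bar> + 1) * p (A z x))) = d * (K * (\<bar>a\<bar> + 1)) * p (A z x)"
      by simp
    finally show ?thesis
      unfolding d by simp
  qed
  then show thesis
    using that[OF d(1), of "2 * K"] K(1) by simp
qed

text \<open>Compactness of the closed disc leaves finitely many of the local bounds, and their sum
  majorizes each of them.\<close>

lemma A_uniformly_bounded:
  obtains M where "0 < M" "\<And>z x. cmod z \<le> r \<Longrightarrow> p (A z x) \<le> M * p x"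
proof -
  have "\<exists>d K. 0 < d \<and> 0 < K \<and> (\<forall>z x. cmod z \<le> r \<longrightarrow> dist w z < d \<longrightarrow> p (A z x) \<le> K * p x)"
    if "w \<in> cball 0 r" for w
    using A_bounded_nearby[of w] that by (metis dist_0_norm mem_cball)
  then obtain d K where dK: "\<And>w. w \<in> cball 0 r \<Longrightarrow> 0 < d w \<and> 0 < K w \<and>
      (\<forall>z x. cmod z \<le> r \<longrightarrow> dist w z < d w \<longrightarrow> p (A z x) \<le> K w * p x)"
    by metis
  have "cball 0 r \<subseteq> (\<Union>w\<in>cball 0 r. ball w (d w))"
    using dK by force
  then obtain C where C: "C \<subseteq> cball 0 r" "finite C" "cball 0 r \<subseteq> (\<Union>w\<in>C. ball w (d w))"
    using compactE_image[of "cball (0::complex) r" "cball 0 r" "\<lambda>w. ball w (d w)"] by auto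
  define M where "M = 1 + (\<Sum>w\<in>C. K w)"
  have K_le: "K w \<le> M" if "w \<in> C" for w
    using member_le_sum[OF that, of K] C dK by (force simp: M_def less_imp_le)
  have "0 < M"
    using sum_nonneg[of C K] C(1) dK by (force simp: M_def less_imp_le)
  moreover have "p (A z x) \<le> M * p x" if "cmod z \<le> r" for z x
  proof -
    obtain w where w: "w \<in> C" "dist w z < d w"
      using C(3) \<open>cmod z \<le> r\<close> by force
    then have "p (A z x) \<le> K w * p x"
      using C(1) dK \<open>cmod z \<le> r\<close> by blast
    also have "\<dots> \<le> M * p x"
      using K_le[OF w(1)] by (simp add: mult_right_mono)
    finally show ?thesis .
  qed
  ultimately show thesis
    using that by blast
qed

text \<open>Raising \<open>k\<close> by one adds \<open>y - z T y\<close> with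
  \<open>y = (z T)^k x\<close>, and \<open>A z\<close> sends this to \<open>y\<close>.\<close>

lemma telescope:
  assumes "cmod z \<le> r"
  shows "A z (x - smul (z ^ k) ((T ^^ k) x)) = (\<Sum>i<k. smul (z ^ i) ((T ^^ i) x))"
proof -
  interpret Az: Vector_Spaces.linear smul smul "A z"
    by (rule linear_A) fact
  show ?thesis
  proof (induction k)
    case (Suc k)
    define y where "y = smul (z ^ k) ((T ^^ k) x)"
    have "x - smul (z ^ Suc k) ((T ^^ Suc k) x) = (x - y) + (y - smul z (T y))"
      by (simp add: y_def T.scale)
    then have "A z (x - smul (z ^ Suc k) ((T ^^ Suc k) x)) = A z (x - y) + A z (y - smul z (T y))"
      by (simp only: Az.add)
    then show ?case
      using Suc left_inverse[OF assms, of y] by (simp add: y_def)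
  qed simp
qed

section \<open>Averages over roots of unity and propagation of decay\<close>

definition unit_root :: "nat \<Rightarrow> nat \<Rightarrow> complex" where
  "unit_root n j = exp (2 * of_real pi * \<i> * of_nat j / of_nat n)"

lemma norm_unit_root [simp]: "cmod (unit_root n j) = 1"
  unfolding unit_root_def by simp

text \<open>Both sides are the exponential of \<open>2 \<pi> \<i> i j / n\<close>. The exchange
  turns a sum over \<open>j\<close> into a geometric series.\<close>

lemma unit_root_power: "unit_root n j ^ i = unit_root n i ^ j"
  unfolding unit_root_def by (simp flip: exp_of_nat_mult add: mult_ac)

lemma unit_root_power_self: "0 < n \<Longrightarrow> unit_root n j ^ n = 1"
  using complex_root_unity[of n j] by (simp add: unit_root_def)

lemma sum_unit_root_powers:
  assumes "i < n"
  shows "(\<Sum>j<n. unit_root n j ^ i) = (if i = 0 then of_nat n else 0)"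
proof (cases "i = 0")
  case False
  then have "unit_root n i \<noteq> 1"
    using complex_root_unity_eq_1[of n i] assms by (auto simp: unit_root_def dest: dvd_imp_le)
  then show ?thesis
    using False assms by (simp add: unit_root_power[of n _ i] geometric_sum unit_root_power_self)
qed simp

text \<open>The average over the \<open>n\<close>-th roots of unity inverts \<open>1 - (t T)\<^sup>n\<close>, yet it inherits from \<open>A\<close> a
  Lipschitz constant that does not depend on \<open>n\<close>.\<close>

definition average :: "nat \<Rightarrow> real \<Rightarrow> 'a \<Rightarrow> 'a" where
  "average n t x = smul (1 / of_nat n) (\<Sum>j<n. A (of_real t * unit_root n j) x)"

text \<open>All points \<open>z j\<close> have the same \<open>n\<close>-th power
  \<open>t ^ n\<close>, so \<open>telescope\<close> applies to one and the same vector;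
  orthogonality of the roots leaves only the term \<open>i = 0\<close>.\<close>

lemma average_left_inverse:
  assumes "0 < n" "\<bar>t\<bar> \<le> r"
  shows "average n t (x - smul (of_real t ^ n) ((T ^^ n) x)) = x"
proof -
  define z where "z j = of_real t * unit_root n j" for j
  have "A (z j) (x - smul (of_real t ^ n) ((T ^^ n) x)) =
      (\<Sum>i<n. smul (unit_root n j ^ i) (smul (of_real t ^ i) ((T ^^ i) x)))" for j
    using telescope[of "z j" x n] assms
    by (simp add: z_def norm_mult power_mult_distrib unit_root_power_self mult_ac)
  then have "(\<Sum>j<n. A (z j) (x - smul (of_real t ^ n) ((T ^^ n) x))) =
      (\<Sum>j<n. \<Sum>i<n. smul (unit_root n j ^ i) (smul (of_real t ^ i) ((T ^^ i) x)))"
    by simp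
  also have "\<dots> = (\<Sum>i<n. smul (\<Sum>j<n. unit_root n j ^ i) (smul (of_real t ^ i) ((T ^^ i) x)))"
    by (subst sum.swap) (simp only: scale_sum_left)
  also have "\<dots> = (\<Sum>i<n. if i = 0 then smul (of_nat n) x else 0)"
    by (rule sum.cong) (auto simp: sum_unit_root_powers)
  also have "\<dots> = smul (of_nat n) x"
    using assms(1) by simp
  finally show ?thesis
    using assms(1) by (simp add: average_def z_def)
qed

lemma average_le:
  assumes "0 < n" and le: "\<And>j. j < n \<Longrightarrow> p (f j) \<le> c"
  shows "p (smul (1 / of_nat n) (\<Sum>j<n. f j)) \<le> c"
proof -
  have "p (\<Sum>j<n. f j) \<le> real n * c"
    using sum_le[of f "{..<n}"] sum_bounded_above[of "{..<n}" "\<lambda>j. p (f j)" c] le by force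
  then show ?thesis
    using assms(1) by (simp add: homogeneous norm_divide field_simps)
qed

text \<open>The estimate being uniform in \<open>x\<close>, this is decay in the operator seminorm
  induced by \<open>p\<close>.\<close>

definition powers_null :: "real \<Rightarrow> bool" where
  "powers_null t \<longleftrightarrow> (\<forall>e>0. \<forall>\<^sub>F n in sequentially. \<forall>x. t ^ n * p ((T ^^ n) x) \<le> e * p x)"

text \<open>The ratio \<open>(t / s) ^ n\<close> tends to zero, so eventual boundedness at
  \<open>s\<close> becomes decay at any smaller \<open>t\<close>.\<close>

lemma powers_null_if_bounded:
  assumes "0 \<le> t" "t < s" "\<forall>\<^sub>F n in sequentially. \<forall>x. s ^ n * p ((T ^^ n) x) \<le> c * p x"
  shows "powers_null t"
  unfolding powers_null_def
proof (intro allI impI)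
  fix e :: real assume "0 < e"
  have "(\<lambda>n. (t / s) ^ n * c) \<longlonglongrightarrow> 0 * c"
    using assms by (intro tendsto_mult LIMSEQ_power_zero tendsto_const) simp
  then have "\<forall>\<^sub>F n in sequentially. (t / s) ^ n * c < e"
    using \<open>0 < e\<close> by (simp add: order_tendstoD)
  with assms(3) show "\<forall>\<^sub>F n in sequentially. \<forall>x. t ^ n * p ((T ^^ n) x) \<le> e * p x"
  proof eventually_elim
    case (elim n)
    show ?case
    proof
      fix x
      have "t ^ n * p ((T ^^ n) x) = (t / s) ^ n * (s ^ n * p ((T ^^ n) x))"
        using assms by (simp add: power_divide)
      also have "\<dots> \<le> (t / s) ^ n * (c * p x)"
        using elim(1) assms by (intro mult_left_mono) auto
      also have "\<dots> = ((t / s) ^ n * c) * p x"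
        by simp
      also have "\<dots> \<le> e * p x"
        using elim(2) by (intro mult_right_mono) auto
      finally show "t ^ n * p ((T ^^ n) x) \<le> e * p x" .
    qed
  qed
qed

text \<open>Decay at \<open>s\<close> makes \<open>average n s\<close> nearly the identity, and the
  Lipschitz bound carries this to a nearby \<open>u\<close>. As the average inverts
  \<open>1 - (u T)^n\<close>, the powers stay bounded at \<open>u\<close> and decay at
  \<open>t < u\<close>.\<close>

lemma powers_null_advance:
  obtains d where "0 < d"
    "\<And>s t. \<lbrakk>powers_null s; 0 \<le> s; 0 \<le> t; t \<le> s + d; s < r; t < r\<rbrakk> \<Longrightarrow> powers_null t"
proof -
  obtain M where M: "0 < M" "\<And>z x. cmod z \<le> r \<Longrightarrow> p (A z x) \<le> M * p x"
    using A_uniformly_bounded by blast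
  \<comment> \<open>The three factors bound \<open>A z\<close>, \<open>T\<close> and
    \<open>A w\<close> in the resolvent identity.\<close>
  define L where "L = M * (\<bar>a\<bar> + 1) * M"
  have "0 < L"
    using M(1) by (simp add: L_def)
  have Lipschitz: "p (A z x - A w x) \<le> L * cmod (z - w) * p x"
    if "cmod z \<le> r" "cmod w \<le> r" for z w x
  proof -
    have "p (A z (T (A w x))) \<le> M * p (T (A w x))"
      by (rule M) fact
    also have "\<dots> \<le> M * ((\<bar>a\<bar> + 1) * p (A w x))"
      using M(1) T_le_abs by (intro mult_left_mono) auto
    also have "\<dots> \<le> M * ((\<bar>a\<bar> + 1) * (M * p x))"
      using M that by (intro mult_left_mono) auto
    finally have "p (A z (T (A w x))) \<le> L * p x"
      by (simp add: L_def mult_ac)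
    then show ?thesis
      using mult_left_mono[of "p (A z (T (A w x)))" "L * p x" "cmod (z - w)"]
      by (simp add: resolvent_identity that homogeneous mult_ac)
  qed
  \<comment> \<open>A displacement of \<open>2 * d\<close> then costs at most
    \<open>L * (2 * d) = 1 / 4\<close>.\<close>
  define d where "d = 1 / (8 * L)"
  have "0 < d"
    using \<open>0 < L\<close> by (simp add: d_def)
  moreover have "powers_null t"
    if s: "powers_null s" and st: "0 \<le> s" "0 \<le> t" "t \<le> s + d" "s < r" "t < r" for s t
  proof -
    \<comment> \<open>An intermediate point strictly beyond \<open>t\<close> that is still in the
      disc.\<close>
    define u where "u = min r (s + 2 * d)"
    have u: "t < u" "0 \<le> u" "u \<le> r" "\<bar>u - s\<bar> \<le> 2 * d"
      using st \<open>0 < d\<close> by (auto simp: u_def)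
    have "0 < 1 / (4 * M)"
      using M(1) by simp
    then have "\<forall>\<^sub>F n in sequentially. \<forall>x. s ^ n * p ((T ^^ n) x) \<le> 1 / (4 * M) * p x"
      using s unfolding powers_null_def by blast
    then have "\<forall>\<^sub>F n in sequentially. \<forall>x. u ^ n * p ((T ^^ n) x) \<le> 1 * p x"
      using eventually_gt_at_top[of 0]
    proof eventually_elim
      case (elim n)
      \<comment> \<open>The error consists of two quarters: one from the decay at \<open>s\<close>,
        one from moving \<open>s\<close> to \<open>u\<close>.\<close>
      have near_id: "p (average n u x - x) \<le> p x / 2" for x
      proof -
        define y where "y = smul (of_real s ^ n) ((T ^^ n) x)"
        have "p y \<le> 1 / (4 * M) * p x"
          using elim(1) st by (simp add: y_def homogeneous norm_power)
        then have y: "M * p y \<le> p x / 4"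
          using M(1) by (simp add: field_simps)
        \<comment> \<open>\<open>average n s\<close> maps \<open>x - y\<close> back to
          \<open>x\<close>, so the deviation is the average applied to the small vector
          \<open>y\<close>.\<close>
        have "average n s x - x = average n s x - average n s (x - y)"
          using average_left_inverse[of n s x] elim(2) st by (simp add: y_def)
        also have "\<dots> = smul (1 / of_nat n) (\<Sum>j<n. A (of_real s * unit_root n j) y)"
        proof -
          have "A (of_real s * unit_root n j) x - A (of_real s * unit_root n j) (x - y) =
              A (of_real s * unit_root n j) y" for j
          proof -
            interpret As: Vector_Spaces.linear smul smul "A (of_real s * unit_root n j)"
              using st by (intro linear_A) (simp add: norm_mult)
            show ?thesis
              by (simp add: As.diff)
          qed
          then show ?thesis
            by (simp add: average_def flip: scale_right_diff_distrib sum_subtractf)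
        qed
        finally have "p (average n s x - x) \<le> M * p y"
          using elim(2) st M(2) by (simp add: average_le norm_mult)
        moreover have "p (average n u x - average n s x) \<le> p x / 4"
        proof -
          have "p (A (of_real u * unit_root n j) x - A (of_real s * unit_root n j) x) \<le> p x / 4" for j
          proof -
            have "cmod (of_real u * unit_root n j - of_real s * unit_root n j) = \<bar>u - s\<bar>"
              by (simp flip: left_diff_distrib of_real_diff add: norm_mult)
            then have "p (A (of_real u * unit_root n j) x - A (of_real s * unit_root n j) x)
                \<le> L * \<bar>u - s\<bar> * p x"
              using Lipschitz[of "of_real u * unit_root n j" "of_real s * unit_root n j" x] u st
              by (simp add: norm_mult)
            also have "\<dots> \<le> L * (2 * d) * p x"
              using u \<open>0 < L\<close> by (intro mult_right_mono mult_left_mono) auto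
            finally show ?thesis
              using \<open>0 < L\<close> by (simp add: d_def)
          qed
          moreover have "average n u x - average n s x = smul (1 / of_nat n)
              (\<Sum>j<n. A (of_real u * unit_root n j) x - A (of_real s * unit_root n j) x)"
            by (simp add: average_def flip: scale_right_diff_distrib sum_subtractf)
          ultimately show ?thesis
            using elim(2) average_le by presburger
        qed
        ultimately show ?thesis
          using triangle[of "average n u x - average n s x" "average n s x - x"] y by simp
      qed
      show ?case
      proof
        fix x
        define v where "v = smul (of_real u ^ n) ((T ^^ n) x)"
        \<comment> \<open>Apply \<open>near_id\<close> to \<open>x - v\<close>, which the average
          maps to \<open>x\<close>. The resulting \<open>p v \<le> (p x + p v) / 2\<close> gives the
          claim by absorption.\<close>
        have "p (x - (x - v)) \<le> p (x - v) / 2"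
          using near_id[of "x - v"] average_left_inverse[of n u x] elim(2) u by (simp add: v_def)
        then have "p v \<le> 1 * p x"
          using diff_le[of x v] by simp
        then show "u ^ n * p ((T ^^ n) x) \<le> 1 * p x"
          using u by (simp add: v_def homogeneous norm_power)
      qed
    qed
    then show ?thesis
      by (rule powers_null_if_bounded[OF st(2) u(1)])
  qed
  ultimately show thesis
    using that by blast
qed

text \<open>Starting at \<open>0\<close>, steps of the fixed length \<open>d\<close> reach
  \<open>t\<close>; truncating at \<open>t\<close> keeps the iterates below
  \<open>r\<close>.\<close>

lemma powers_null_below_radius:
  assumes "0 \<le> t" "t < r"
  shows "powers_null t"
proof -
  obtain d where d: "0 < d"
    "\<And>s t. \<lbrakk>powers_null s; 0 \<le> s; 0 \<le> t; t \<le> s + d; s < r; t < r\<rbrakk> \<Longrightarrow> powers_null t"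
    using powers_null_advance by blast
  have "powers_null (min t (real k * d))" for k
  proof (induction k)
    \<comment> \<open>At parameter \<open>0\<close> every power but the zeroth vanishes; since
      \<open>0 ^ 0 = 1\<close>, the estimate is made for \<open>n > 0\<close>.\<close>
    case 0
    have "\<forall>\<^sub>F n in sequentially. \<forall>x. 0 ^ n * p ((T ^^ n) x) \<le> e * p x" if "0 < e" for e
      using eventually_gt_at_top[of 0]
    proof eventually_elim
      case (elim n)
      then show ?case
        using that by (simp add: zero_power)
    qed
    then show ?case
      using assms by (simp add: powers_null_def)
  next
    case (Suc k)
    show ?case
      by (rule d(2)[OF Suc]) (use d(1) assms in \<open>auto simp: distrib_right min_def\<close>)
  qed
  moreover obtain k where "t < real k * d"
    using reals_Archimedean3[OF d(1)] by blast
  ultimately show ?thesis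
    by (metis less_imp_le min.absorb1)
qed

end

section \<open>Boundedness in terms of seminorms\<close>

lemma linear_iff_same_space:
  assumes "vector_space s"
  shows "Vector_Spaces.linear s s f \<longleftrightarrow>
    (\<forall>x y. f (x + y) = f x + f y) \<and> (\<forall>c x. f (s c x) = s c (f x))"
  using assms by (simp add: Vector_Spaces.linear_iff)

context vector_space
begin

lemma linear_funpow:
  assumes "Vector_Spaces.linear scale scale T"
  shows "Vector_Spaces.linear scale scale (T ^^ n)"
  using assms unfolding linear_iff_same_space[OF vector_space_axioms] by (induction n) auto

lemma linear_scaled:
  assumes "Vector_Spaces.linear scale scale T"
  shows "Vector_Spaces.linear scale scale (\<lambda>x. scale c (T x))"
  using assms unfolding linear_iff_same_space[OF vector_space_axioms]
  by (simp add: scale_right_distrib scale_left_commute)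

lemma linear_comp:
  assumes "Vector_Spaces.linear scale scale S" "Vector_Spaces.linear scale scale T"
  shows "Vector_Spaces.linear scale scale (\<lambda>x. S (T x))"
  using assms unfolding linear_iff_same_space[OF vector_space_axioms] by simp

end

text \<open>Homogeneity extends the bound from the ball to the whole space; a small positive slack
  \<open>d\<close> covers the case \<open>p x = 0\<close>.\<close>

lemma seminorm_le_if_bounded_on_ball:
  assumes "complex_seminorm smul p" "complex_seminorm smul q"
    and "Vector_Spaces.linear smul smul T"
    and le: "\<And>x. p x < 1 \<Longrightarrow> q (T x) \<le> K"
  shows "q (T x) \<le> K * p x"
proof -
  interpret p: complex_seminorm smul p by fact
  interpret q: complex_seminorm smul q by fact
  interpret T: Vector_Spaces.linear smul smul T by fact
  have "0 \<le> K"
    using le[of 0] by simp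
  show ?thesis
  proof (rule field_le_epsilon)
    fix e :: real assume "0 < e"
    define d where "d = e / (K + 1)"
    have d: "0 < d" "K * d \<le> e"
      using \<open>0 < e\<close> \<open>0 \<le> K\<close> by (simp_all add: d_def field_simps)
    obtain y where y: "x = smul (of_real (p x + d)) y" "p y < 1"
      using p.scaled_into_ball[OF d(1)] .
    have "q (T x) = (p x + d) * q (T y)"
      using d(1) p.nonneg[of x] y(1)
      by (metis T.scale q.homogeneous norm_of_real abs_of_nonneg add_nonneg_nonneg less_imp_le)
    also have "\<dots> \<le> (p x + d) * K"
      using d(1) le[OF y(2)] by (intro mult_left_mono) auto
    finally show "q (T x) \<le> K * p x + e"
      using d(2) by (simp add: algebra_simps)
  qed
qed

context complex_lcs
begin

lemma tvs_bounded_iff: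
  "tvs_bounded smul B \<longleftrightarrow> (\<forall>p. continuous_seminorm p \<longrightarrow> (\<exists>K. \<forall>x\<in>B. p x \<le> K))"
proof (intro iffI allI impI)
  fix p assume B: "tvs_bounded smul B" and p: "continuous_seminorm p"
  interpret p: complex_seminorm smul p
    using p by (rule continuous_seminormD)
  obtain c :: real where "0 < c" "B \<subseteq> smul (of_real c) ` {x. p x < 1}"
    using B p unfolding tvs_bounded_def continuous_seminorm_def by blast
  then have "\<forall>x\<in>B. p x \<le> c"
    by (subst (asm) p.scaled_ball) (auto simp: less_imp_le)
  then show "\<exists>K. \<forall>x\<in>B. p x \<le> K" ..
next
  assume *: "\<forall>p. continuous_seminorm p \<longrightarrow> (\<exists>K. \<forall>x\<in>B. p x \<le> K)"
  show "tvs_bounded smul B"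
    unfolding tvs_bounded_def
  proof (intro allI impI)
    fix U :: "'a set" assume "zero_nbhd U"
    then obtain p where p: "continuous_seminorm p" "{x. p x < 1} \<subseteq> U"
      using continuous_seminorm_in_nbhd by blast
    interpret p: complex_seminorm smul p
      using p(1) by (rule continuous_seminormD)
    obtain K where K: "\<forall>x\<in>B. p x \<le> K"
      using * p(1) by blast
    define c where "c = \<bar>K\<bar> + 1"
    have "0 < c"
      by (simp add: c_def)
    have "B \<subseteq> {x. p x < c}"
    proof
      fix x assume "x \<in> B"
      then show "x \<in> {x. p x < c}"
        using bspec[OF K, of x] by (simp add: c_def)
    qed
    also have "\<dots> = smul (of_real c) ` {x. p x < 1}"
      using \<open>0 < c\<close> by (subst p.scaled_ball) auto
    also have "\<dots> \<subseteq> smul (of_real c) ` U"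
      using p(2) by (rule image_mono)
    finally show "\<exists>c>0. B \<subseteq> smul (of_real c) ` U"
      using \<open>0 < c\<close> by blast
  qed
qed

lemma tvs_bounded_image_ball:
  assumes "continuous_seminorm p"
    and "\<And>q. continuous_seminorm q \<Longrightarrow> \<exists>K. \<forall>x. q (T x) \<le> K * p x"
  shows "tvs_bounded smul (T ` {x. p x < 1})"
  unfolding tvs_bounded_iff
proof (intro allI impI)
  interpret p: complex_seminorm smul p
    using assms(1) by (rule continuous_seminormD)
  fix q assume "continuous_seminorm q"
  then obtain K where K: "\<And>x. q (T x) \<le> K * p x"
    using assms(2) by blast
  have "q (T x) \<le> \<bar>K\<bar>" if "p x < 1" for x
  proof -
    have "K * p x \<le> \<bar>K\<bar> * 1"
      using that by (intro mult_mono) auto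
    then show ?thesis
      using K[of x] by simp
  qed
  then show "\<exists>K. \<forall>x\<in>T ` {x. p x < 1}. q x \<le> K"
    by blast
qed

text \<open>One \<open>p\<close> serves every \<open>q\<close>, because its ball lies in a
  neighborhood with bounded image. For mere continuity \<open>p\<close> may depend on
  \<open>q\<close>.\<close>

lemma nb_bounded_iff:
  assumes "Vector_Spaces.linear smul smul T"
  shows "nb_bounded smul T \<longleftrightarrow>
    (\<exists>p. continuous_seminorm p \<and>
      (\<forall>q. continuous_seminorm q \<longrightarrow> (\<exists>K. \<forall>x. q (T x) \<le> K * p x)))"
proof
  assume "nb_bounded smul T"
  then obtain U where U: "zero_nbhd U" "tvs_bounded smul (T ` U)"
    unfolding nb_bounded_def by blast
  obtain p where p: "continuous_seminorm p" "{x. p x < 1} \<subseteq> U"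
    using continuous_seminorm_in_nbhd[OF U(1)] .
  have "\<exists>K. \<forall>x. q (T x) \<le> K * p x" if "continuous_seminorm q" for q
  proof -
    obtain K where K: "\<forall>x\<in>U. q (T x) \<le> K"
      using U(2) \<open>continuous_seminorm q\<close> unfolding tvs_bounded_iff by auto
    have "q (T x) \<le> K * p x" for x
      by (rule seminorm_le_if_bounded_on_ball[OF _ _ assms])
        (use p \<open>continuous_seminorm q\<close> K in \<open>auto intro: continuous_seminormD\<close>)
    then show ?thesis by blast
  qed
  then show "\<exists>p. continuous_seminorm p \<and>
      (\<forall>q. continuous_seminorm q \<longrightarrow> (\<exists>K. \<forall>x. q (T x) \<le> K * p x))"
    using p(1) by blast
next
  assume "\<exists>p. continuous_seminorm p \<and>
      (\<forall>q. continuous_seminorm q \<longrightarrow> (\<exists>K. \<forall>x. q (T x) \<le> K * p x))"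
  then obtain p where p: "continuous_seminorm p"
    "\<And>q. continuous_seminorm q \<Longrightarrow> \<exists>K. \<forall>x. q (T x) \<le> K * p x"
    by blast
  have "tvs_bounded smul (T ` {x. p x < 1})"
    by (rule tvs_bounded_image_ball[OF p])
  then show "nb_bounded smul T"
    using p(1) unfolding nb_bounded_def continuous_seminorm_def by blast
qed

lemma continuous_on_iff_seminorms:
  assumes "Vector_Spaces.linear smul smul T"
  shows "continuous_on UNIV T \<longleftrightarrow>
    (\<forall>q. continuous_seminorm q \<longrightarrow> (\<exists>p K. continuous_seminorm p \<and> (\<forall>x. q (T x) \<le> K * p x)))"
proof -
  interpret T: Vector_Spaces.linear smul smul T by fact
  have iff: "continuous_on UNIV T \<longleftrightarrow> (\<forall>V. zero_nbhd V \<longrightarrow> zero_nbhd {x. T x \<in> V})"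
    unfolding continuous_on_UNIV_iff_at_zero[OF T.add] filterlim_iff
  proof (intro iffI allI impI)
    fix V :: "'a set"
    assume *: "\<forall>P. eventually P (nhds 0) \<longrightarrow> (\<forall>\<^sub>F x in nhds 0. P (T x))" and "zero_nbhd V"
    then show "zero_nbhd {x. T x \<in> V}"
      using spec[OF *, of "\<lambda>x. x \<in> V"] by (simp add: zero_nbhd_def)
  next
    fix P :: "'a \<Rightarrow> bool"
    assume *: "\<forall>V. zero_nbhd V \<longrightarrow> zero_nbhd {x. T x \<in> V}" and "eventually P (nhds 0)"
    then show "\<forall>\<^sub>F x in nhds 0. P (T x)"
      using spec[OF *, of "Collect P"] by (simp add: zero_nbhd_def)
  qed
  show ?thesis
  proof (intro iffI allI impI)
    fix q assume *: "continuous_on UNIV T" and q: "continuous_seminorm q"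
    then have "zero_nbhd {x. T x \<in> {x. q x < 1}}"
      unfolding iff continuous_seminorm_def by blast
    then obtain p where p: "continuous_seminorm p" "{x. p x < 1} \<subseteq> {x. T x \<in> {x. q x < 1}}"
      using continuous_seminorm_in_nbhd by blast
    have "q (T x) \<le> 1 * p x" for x
      by (rule seminorm_le_if_bounded_on_ball[OF _ _ assms])
        (use p q in \<open>auto intro: continuous_seminormD less_imp_le\<close>)
    then show "\<exists>p K. continuous_seminorm p \<and> (\<forall>x. q (T x) \<le> K * p x)"
      using p(1) by blast
  next
    assume *: "\<forall>q. continuous_seminorm q \<longrightarrow>
      (\<exists>p K. continuous_seminorm p \<and> (\<forall>x. q (T x) \<le> K * p x))"
    show "continuous_on UNIV T"
      unfolding iff
    proof (intro allI impI)
      fix V :: "'a set" assume "zero_nbhd V"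
      then obtain q where q: "continuous_seminorm q" "{x. q x < 1} \<subseteq> V"
        using continuous_seminorm_in_nbhd by blast
      then obtain p K where p: "continuous_seminorm p" "\<And>x. q (T x) \<le> K * p x"
        using * by blast
      interpret p: complex_seminorm smul p
        using p(1) by (rule continuous_seminormD)
      have "T x \<in> V" if "p x < 1 / (\<bar>K\<bar> + 1)" for x
      proof -
        have "q (T x) \<le> (\<bar>K\<bar> + 1) * p x"
          by (rule order_trans[OF p(2)]) (intro mult_right_mono; simp)
        also have "\<dots> < 1"
          using that by (simp add: pos_less_divide_eq mult.commute)
        finally show ?thesis
          using q(2) by blast
      qed
      then have "{x. p x < 1 / (\<bar>K\<bar> + 1)} \<subseteq> {x. T x \<in> V}"
        by blast
      moreover have "0 < 1 / (\<bar>K\<bar> + 1)"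
        by (simp add: add_nonneg_pos)
      ultimately show "zero_nbhd {x. T x \<in> V}"
        using zero_nbhd_mono zero_nbhd_ball[OF p(1)] by blast
    qed
  qed
qed

lemma bb_bounded_if_continuous:
  assumes "Vector_Spaces.linear smul smul T" "continuous_on UNIV T"
  shows "bb_bounded smul T"
  unfolding bb_bounded_def tvs_bounded_iff
proof (intro allI impI)
  fix B q
  assume B: "\<forall>p. continuous_seminorm p \<longrightarrow> (\<exists>K. \<forall>x\<in>B. p x \<le> K)" and q: "continuous_seminorm q"
  obtain p K where p: "continuous_seminorm p" "\<And>x. q (T x) \<le> K * p x"
    using assms q continuous_on_iff_seminorms by blast
  interpret p: complex_seminorm smul p
    using p(1) by (rule continuous_seminormD)
  obtain C where C: "\<And>x. x \<in> B \<Longrightarrow> p x \<le> C"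
    using B p(1) by blast
  have "q (T x) \<le> \<bar>K\<bar> * C" if "x \<in> B" for x
  proof -
    have "K * p x \<le> \<bar>K\<bar> * C"
      using C[OF that] by (intro mult_mono) auto
    then show ?thesis
      using p(2)[of x] by simp
  qed
  then show "\<exists>K. \<forall>x\<in>T ` B. q x \<le> K"
    by blast
qed

text \<open>A base member \<open>U\<close> inside the unit ball of \<open>q\<close> is mapped into
  \<open>c U\<close>, hence into the ball of \<open>q\<close> with radius \<open>c\<close>.\<close>

lemma continuous_if_nn_bounded:
  assumes "Vector_Spaces.linear smul smul T" "nn_bounded smul T"
  shows "continuous_on UNIV T"
  unfolding continuous_on_iff_seminorms[OF assms(1)]
proof (intro allI impI)
  fix q assume q: "continuous_seminorm q"
  interpret q: complex_seminorm smul q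
    using q by (rule continuous_seminormD)
  obtain N where N: "zero_base smul N" "\<And>U. U \<in> N \<Longrightarrow> \<exists>c::real. c > 0 \<and> T ` U \<subseteq> smul (of_real c) ` U"
    using assms(2) unfolding nn_bounded_def by blast
  obtain U where U: "U \<in> N" "U \<subseteq> {x. q x < 1}" "zero_nbhd U"
    using N(1) q unfolding zero_base_def continuous_seminorm_def by meson
  obtain c :: real where c: "c > 0" "T ` U \<subseteq> smul (of_real c) ` U"
    using N(2)[OF U(1)] by blast
  obtain p where p: "continuous_seminorm p" "{x. p x < 1} \<subseteq> U"
    using continuous_seminorm_in_nbhd[OF U(3)] .
  have "smul (of_real c) ` U \<subseteq> smul (of_real c) ` {x. q x < 1}"
    using U(2) by (rule image_mono)
  then have "q (T x) < c" if "x \<in> U" for x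
    using c that by (subst (asm) q.scaled_ball) auto
  then have "q (T x) \<le> c * p x" for x
    by (intro seminorm_le_if_bounded_on_ball[OF _ _ assms(1)])
      (use p q in \<open>auto intro: continuous_seminormD less_imp_le\<close>)
  then show "\<exists>p K. continuous_seminorm p \<and> (\<forall>x. q (T x) \<le> K * p x)"
    using p(1) by blast
qed

section \<open>A base of zero neighborhoods adapted to one seminorm\<close>

definition dominating_seminorm :: "('a \<Rightarrow> real) \<Rightarrow> ('a \<Rightarrow> real) \<Rightarrow> bool" where
  "dominating_seminorm p q \<longleftrightarrow> continuous_seminorm q \<and> (\<exists>K. \<forall>x. p x \<le> K * q x)"

lemma dominating_seminormE:
  assumes "dominating_seminorm p q"
  obtains K where "0 \<le> K" "\<And>x. p x \<le> K * q x"
proof -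
  obtain K where K: "\<And>x. p x \<le> K * q x" and "continuous_seminorm q"
    using assms unfolding dominating_seminorm_def by blast
  interpret q: complex_seminorm smul q
    using \<open>continuous_seminorm q\<close> by (rule continuous_seminormD)
  have "p x \<le> \<bar>K\<bar> * q x" for x
    by (rule order_trans[OF K]) (intro mult_right_mono; simp)
  then show thesis
    using that[of "\<bar>K\<bar>"] by simp
qed

lemma dominating_seminorm_max:
  assumes "dominating_seminorm p q" "continuous_seminorm q'"
  shows "dominating_seminorm p (\<lambda>x. max (q x) (q' x))"
proof -
  obtain K where K: "0 \<le> K" "\<And>x. p x \<le> K * q x"
    using dominating_seminormE[OF assms(1)] by blast
  have "p x \<le> K * max (q x) (q' x)" for x
    by (rule order_trans[OF K(2)]) (intro mult_left_mono; use K in simp)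
  then show ?thesis
    using assms continuous_seminorm_max unfolding dominating_seminorm_def by blast
qed

text \<open>The constant \<open>K\<close> absorbs \<open>r\<close>; this is what closes
  \<open>dominating_base\<close> under nonzero scalars.\<close>

lemma dominating_seminorm_scale:
  assumes "dominating_seminorm p q" "0 < r"
  shows "dominating_seminorm p (\<lambda>x. r * q x)"
proof -
  obtain K where "\<And>x. p x \<le> K * q x"
    using assms unfolding dominating_seminorm_def by blast
  then have "p x \<le> K / r * (r * q x)" for x
    using assms(2) by simp
  then show ?thesis
    using assms continuous_seminorm_scale unfolding dominating_seminorm_def by blast
qed

text \<open>A base on which every linear map that is bounded with respect to \<open>p\<close> acts boundedly:
  such a map is bounded with respect to each seminorm dominating \<open>p\<close>.\<close>

definition dominating_base :: "('a \<Rightarrow> real) \<Rightarrow> 'a set set" where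
  "dominating_base p = (\<lambda>q. {x. q x < 1}) ` Collect (dominating_seminorm p)"

text \<open>The requirements turn into operations on seminorms: intersecting balls takes a maximum,
  scaling a ball rescales the seminorm, and doubling the seminorm halves the ball.\<close>

lemma zero_base_dominating:
  assumes "continuous_seminorm p"
  shows "zero_base smul (dominating_base p)"
proof -
  have p: "dominating_seminorm p p"
    using assms unfolding dominating_seminorm_def by (auto intro: exI[of _ 1])
  have seminorm: "complex_seminorm smul q" if "dominating_seminorm p q" for q
    using that continuous_seminormD unfolding dominating_seminorm_def by blast
  have base: "{x. q x < 1} \<in> dominating_base p" if "dominating_seminorm p q" for q
    using that unfolding dominating_base_def by blast
  show ?thesis
    unfolding zero_base_def
  proof (intro conjI ballI allI impI)
    fix V :: "'a set" assume "zero_nbhd V"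
    then obtain q where q: "continuous_seminorm q" "{x. q x < 1} \<subseteq> V"
      using continuous_seminorm_in_nbhd by blast
    \<comment> \<open>Taking the maximum with \<open>p\<close> forces domination and only shrinks
      the ball of \<open>q\<close>.\<close>
    have "{x. max (p x) (q x) < 1} \<in> dominating_base p"
      by (intro base dominating_seminorm_max p q)
    moreover have "{x. max (p x) (q x) < 1} \<subseteq> V"
      using q(2) by auto
    ultimately show "\<exists>U\<in>dominating_base p. U \<subseteq> V" by blast
  next
    fix U assume "U \<in> dominating_base p"
    then obtain q where q: "dominating_seminorm p q" "U = {x. q x < 1}"
      unfolding dominating_base_def by blast
    interpret q: complex_seminorm smul q
      using q(1) by (rule seminorm)
    show "zero_nbhd U"
      using q unfolding dominating_seminorm_def continuous_seminorm_def by blast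
    show "balanced_set smul U"
      unfolding q(2) by (rule q.balanced_ball)
    show "convex_set smul U"
      unfolding convex_set_def q(2)
    proof (intro ballI allI impI)
      fix x y and u v :: real
      assume *: "x \<in> {x. q x < 1}" "y \<in> {x. q x < 1}" "0 \<le> u" "0 \<le> v" "u + v = 1"
      have "q (smul (of_real u) x + smul (of_real v) y) \<le> u * q x + v * q y"
        using q.triangle[of "smul (of_real u) x" "smul (of_real v) y"] *
        by (simp add: q.homogeneous)
      also have "\<dots> < 1"
        using * by (intro convex_bound_lt) auto
      finally show "smul (of_real u) x + smul (of_real v) y \<in> {x. q x < 1}"
        by simp
    qed
    fix c :: complex assume "c \<noteq> 0"
    then have "smul c ` U = {x. 1 / cmod c * q x < 1}"
      unfolding q(2) by (subst q.scaled_ball) (auto simp: field_simps)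
    then show "smul c ` U \<in> dominating_base p"
      using base[OF dominating_seminorm_scale[OF q(1), of "1 / cmod c"]] \<open>c \<noteq> 0\<close> by simp
  next
    fix V1 V2 assume "V1 \<in> dominating_base p" "V2 \<in> dominating_base p"
    then obtain q1 q2 where q: "dominating_seminorm p q1" "V1 = {x. q1 x < 1}"
      "dominating_seminorm p q2" "V2 = {x. q2 x < 1}"
      unfolding dominating_base_def by blast
    have "{x. max (q1 x) (q2 x) < 1} \<in> dominating_base p"
      using q by (intro base dominating_seminorm_max) (auto simp: dominating_seminorm_def)
    moreover have "{x. max (q1 x) (q2 x) < 1} \<subseteq> V1 \<inter> V2"
      using q by auto
    ultimately show "\<exists>W\<in>dominating_base p. W \<subseteq> V1 \<inter> V2" by blast
  next
    fix V assume "V \<in> dominating_base p"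
    then obtain q where q: "dominating_seminorm p q" "V = {x. q x < 1}"
      unfolding dominating_base_def by blast
    interpret q: complex_seminorm smul q
      using q(1) by (rule seminorm)
    have "{x. 2 * q x < 1} \<in> dominating_base p"
      using q by (intro base dominating_seminorm_scale) auto
    moreover have "q (x + y) < 1" if "2 * q x < 1" "2 * q y < 1" for x y
      using q.triangle[of x y] that by linarith
    ultimately show "\<exists>U\<in>dominating_base p. {x + y |x y. x \<in> U \<and> y \<in> U} \<subseteq> V"
      unfolding q(2) by (intro bexI[of _ "{x. 2 * q x < 1}"]) auto
  qed
qed

text \<open>If \<open>q\<close> dominates \<open>p\<close>, then \<open>q (S x)\<close> is at most a
  multiple of \<open>p x\<close>, hence of \<open>q x\<close>, so the sum acts boundedly on every
  ball in \<open>dominating_base p\<close>.\<close>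

lemma nn_bounded_scalar_plus_nb_bounded:
  assumes "Vector_Spaces.linear smul smul S" "nb_bounded smul S"
  shows "nn_bounded smul (\<lambda>x. smul c x + S x)"
proof -
  obtain p where p: "continuous_seminorm p"
    "\<And>q. continuous_seminorm q \<Longrightarrow> \<exists>K. \<forall>x. q (S x) \<le> K * p x"
    using assms nb_bounded_iff by blast
  have "\<exists>\<alpha>::real. \<alpha> > 0 \<and> (\<lambda>x. smul c x + S x) ` U \<subseteq> smul (of_real \<alpha>) ` U"
    if U: "U \<in> dominating_base p" for U
  proof -
    obtain q where q: "dominating_seminorm p q" "U = {x. q x < 1}"
      using U unfolding dominating_base_def by blast
    then have "continuous_seminorm q"
      by (simp add: dominating_seminorm_def)
    interpret q: complex_seminorm smul q
      using \<open>continuous_seminorm q\<close> by (rule continuous_seminormD)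
    interpret p: complex_seminorm smul p
      using p(1) by (rule continuous_seminormD)
    obtain K where K: "\<And>x. q (S x) \<le> K * p x"
      using p(2)[OF \<open>continuous_seminorm q\<close>] by blast
    obtain L where L: "0 \<le> L" "\<And>x. p x \<le> L * q x"
      using dominating_seminormE[OF q(1)] by blast
    define \<alpha> where "\<alpha> = cmod c + \<bar>K\<bar> * L + 1"
    have "0 < \<alpha>"
      using L(1) by (simp add: \<alpha>_def add_nonneg_pos)
    have "q (smul c x + S x) < \<alpha>" if "q x < 1" for x
    proof -
      have "q (S x) \<le> \<bar>K\<bar> * p x"
        by (rule order_trans[OF K]) (intro mult_right_mono; simp)
      also have "\<dots> \<le> \<bar>K\<bar> * (L * 1)"
        using that L by (intro mult_left_mono order_trans[OF L(2)]) auto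
      finally have "q (S x) \<le> \<bar>K\<bar> * L" by simp
      moreover have "cmod c * q x \<le> cmod c * 1"
        using that by (intro mult_left_mono) auto
      ultimately show ?thesis
        using q.triangle[of "smul c x" "S x"] by (simp add: q.homogeneous \<alpha>_def)
    qed
    moreover have "smul (of_real \<alpha>) ` U = {x. q x < \<alpha>}"
      unfolding q(2) using \<open>0 < \<alpha>\<close> by (subst q.scaled_ball) auto
    ultimately show ?thesis
      using \<open>0 < \<alpha>\<close> q(2) by (intro exI[of _ \<alpha>]) auto
  qed
  then show ?thesis
    using zero_base_dominating[OF p(1)] unfolding nn_bounded_def by blast
qed

end

section \<open>Comparison of the spectra and of the radii\<close>

lemma resolvent_set_mono:
  assumes "\<And>R. Vector_Spaces.linear smul smul R \<Longrightarrow> P R \<Longrightarrow> Q R"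
  shows "resolvent_set smul P T \<subseteq> resolvent_set smul Q T"
  using assms unfolding resolvent_set_def by blast

text \<open>The point \<open>0\<close> contributes only the least value of \<open>ennreal\<close>,
  so comparing spectra away from zero is enough.\<close>

lemma spectrum_modulus_mono:
  assumes "\<sigma> - {0} \<subseteq> \<tau>"
  shows "spectrum_modulus \<sigma> \<le> spectrum_modulus \<tau>"
  unfolding spectrum_modulus_def
proof (rule SUP_least)
  fix c assume "c \<in> \<sigma>"
  then show "ennreal (cmod c) \<le> (SUP \<mu>\<in>\<tau>. ennreal (cmod \<mu>))"
    using assms by (cases "c = 0") (auto intro: SUP_upper)
qed

text \<open>A stronger mode of convergence admits fewer \<open>\<nu>\<close>, so its infimum is
  larger.\<close>

lemma radius_wrt_antimono:
  assumes "\<And>\<nu>. \<nu> > 0 \<Longrightarrow> N (\<lambda>n x. smul (of_real (1 / \<nu> ^ n)) ((T ^^ n) x)) \<Longrightarrow>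
      M (\<lambda>n x. smul (of_real (1 / \<nu> ^ n)) ((T ^^ n) x))"
  shows "radius_wrt smul M T \<le> radius_wrt smul N T"
  unfolding radius_wrt_def using assms by (intro Inf_superset_mono) blast

section \<open>Agreement of the spectra away from zero\<close>

context complex_lcs
begin

definition scalar_plus_nb :: "('a \<Rightarrow> 'a) \<Rightarrow> bool" where
  "scalar_plus_nb R \<longleftrightarrow>
    (\<exists>\<alpha> S. Vector_Spaces.linear smul smul S \<and> nb_bounded smul S \<and> R = (\<lambda>x. smul \<alpha> x + S x))"

lemma nb_bounded_comp:
  assumes "Vector_Spaces.linear smul smul T" "nb_bounded smul T"
    and "Vector_Spaces.linear smul smul R" "bb_bounded smul R"
  shows "nb_bounded smul (\<lambda>x. R (T x))"
  using assms(2,4) unfolding nb_bounded_def bb_bounded_def by (metis image_image)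

text \<open>Solving \<open>R (\<mu> x - T x) = x\<close> for \<open>R x\<close> exhibits \<open>R\<close> as \<open>\<mu>\<^sup>-\<^sup>1 (x + R (T x))\<close>.\<close>

lemma scalar_plus_nb_resolvent:
  assumes T: "Vector_Spaces.linear smul smul T" "nb_bounded smul T"
    and R: "Vector_Spaces.linear smul smul R" "bb_bounded smul R"
    and inverse: "R \<circ> (\<lambda>x. smul \<mu> x - T x) = id" and "\<mu> \<noteq> 0"
  shows "scalar_plus_nb R"
proof -
  interpret R: Vector_Spaces.linear smul smul R by fact
  have linear_T': "Vector_Spaces.linear smul smul (\<lambda>x. T (smul (1 / \<mu>) x))"
    using linear_comp[OF T(1) linear_scaled[OF linear_id]] by simp
  obtain U where U: "zero_nbhd U" "tvs_bounded smul (T ` U)"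
    using T(2) unfolding nb_bounded_def by blast
  \<comment> \<open>Rescaling the neighborhood by \<open>\<mu>\<close> cancels the inner factor
    \<open>1 / \<mu>\<close>.\<close>
  have "(\<lambda>x. T (smul (1 / \<mu>) x)) ` (smul \<mu> ` U) = T ` U"
    using \<open>\<mu> \<noteq> 0\<close> by (simp add: image_image)
  then have "nb_bounded smul (\<lambda>x. T (smul (1 / \<mu>) x))"
    using U zero_nbhd_scale[OF U(1) \<open>\<mu> \<noteq> 0\<close>] unfolding nb_bounded_def by metis
  note nb = nb_bounded_comp[OF linear_T' this R]
  have "R x = smul (1 / \<mu>) x + R (T (smul (1 / \<mu>) x))" for x
  proof -
    have "R (x - T (smul (1 / \<mu>) x)) = smul (1 / \<mu>) x"
      using fun_cong[OF inverse, of "smul (1 / \<mu>) x"] \<open>\<mu> \<noteq> 0\<close> by simp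
    then show ?thesis
      by (simp add: R.diff algebra_simps)
  qed
  moreover have "Vector_Spaces.linear smul smul (\<lambda>x. R (T (smul (1 / \<mu>) x)))"
    by (rule linear_comp[OF R(1) linear_T'])
  ultimately show ?thesis
    using nb unfolding scalar_plus_nb_def by blast
qed

lemma bounded_inverse_hierarchy:
  assumes "Vector_Spaces.linear smul smul R"
  shows "scalar_plus_nb R \<Longrightarrow> nn_bounded smul R"
    and "nn_bounded smul R \<Longrightarrow> continuous_on UNIV R"
    and "continuous_on UNIV R \<Longrightarrow> bb_bounded smul R"
  using nn_bounded_scalar_plus_nb_bounded continuous_if_nn_bounded[OF assms]
    bb_bounded_if_continuous[OF assms] by (auto simp: scalar_plus_nb_def)

text \<open>Every spectrum lies between \<open>spectrum_bb\<close> and \<open>spectrum_nb\<close>,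
  and by \<open>scalar_plus_nb_resolvent\<close> these two differ at most in the point
  \<open>0\<close>.\<close>

lemma spectrum_modulus_eq:
  assumes "Vector_Spaces.linear smul smul T" "nb_bounded smul T"
    and "\<sigma> \<in> {spectrum_bb smul T, spectrum_c smul T, spectrum_nn smul T, spectrum_nb smul T}"
  shows "spectrum_modulus \<sigma> = spectrum_modulus (spectrum_bb smul T)"
proof (rule antisym)
  have nb: "spectrum_nb smul T = - resolvent_set smul scalar_plus_nb T"
    unfolding spectrum_nb_def by (simp flip: scalar_plus_nb_def)
  have "resolvent_set smul scalar_plus_nb T \<subseteq> resolvent_set smul (nn_bounded smul) T"
    "resolvent_set smul (nn_bounded smul) T \<subseteq> resolvent_set smul (continuous_on UNIV) T"
    "resolvent_set smul (continuous_on UNIV) T \<subseteq> resolvent_set smul (bb_bounded smul) T"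
    using bounded_inverse_hierarchy by (intro resolvent_set_mono; blast)+
  then have "spectrum_bb smul T \<subseteq> \<sigma>" and sub: "\<sigma> \<subseteq> spectrum_nb smul T"
    using assms(3) unfolding nb spectrum_bb_def spectrum_c_def spectrum_nn_def by auto
  then show "spectrum_modulus (spectrum_bb smul T) \<le> spectrum_modulus \<sigma>"
    by (intro spectrum_modulus_mono) auto
  have "resolvent_set smul (bb_bounded smul) T - {0} \<subseteq> resolvent_set smul scalar_plus_nb T"
    using scalar_plus_nb_resolvent[OF assms(1,2)] unfolding resolvent_set_def by blast
  then show "spectrum_modulus \<sigma> \<le> spectrum_modulus (spectrum_bb smul T)"
    using sub unfolding nb spectrum_bb_def by (intro spectrum_modulus_mono) blast
qed

section \<open>Agreement of the four radii\<close>

lemma uniformly_null_on_iff: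
  "uniformly_null_on A S \<longleftrightarrow>
    (\<forall>q e. continuous_seminorm q \<longrightarrow> 0 < e \<longrightarrow> (\<forall>\<^sub>F n in sequentially. \<forall>x\<in>A. q (S n x) < e))"
proof (intro iffI allI impI)
  fix q and e :: real
  assume *: "uniformly_null_on A S" and "continuous_seminorm q" "0 < e"
  then have "\<forall>\<^sub>F n in sequentially. S n ` A \<subseteq> {x. q x < e}"
    using zero_nbhd_ball unfolding uniformly_null_on_def by blast
  then show "\<forall>\<^sub>F n in sequentially. \<forall>x\<in>A. q (S n x) < e"
    by (rule eventually_mono) blast
next
  assume *: "\<forall>q e. continuous_seminorm q \<longrightarrow> 0 < e \<longrightarrow>
    (\<forall>\<^sub>F n in sequentially. \<forall>x\<in>A. q (S n x) < e)"
  show "uniformly_null_on A S"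
    unfolding uniformly_null_on_def
  proof (intro allI impI)
    fix V :: "'a set" assume "zero_nbhd V"
    then obtain q where "continuous_seminorm q" "{x. q x < 1} \<subseteq> V"
      using continuous_seminorm_in_nbhd by blast
    moreover from this have "\<forall>\<^sub>F n in sequentially. \<forall>x\<in>A. q (S n x) < 1"
      using * zero_less_one by blast
    ultimately show "\<forall>\<^sub>F n in sequentially. S n ` A \<subseteq> V"
      by (auto elim!: eventually_mono)
  qed
qed

text \<open>Take \<open>p\<close> with unit ball inside the neighborhood of uniform convergence. For
  \<open>q\<close> dominating \<open>p\<close>, small bounds on the ball of \<open>p\<close>
  transfer to the ball of \<open>q\<close>.\<close>

lemma nn_null_if_nb_null:
  assumes "\<And>n. Vector_Spaces.linear smul smul (S n)" "nb_null S"
  shows "nn_null smul S"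
proof -
  obtain U where U: "zero_nbhd U" "uniformly_null_on U S"
    using assms(2) unfolding nb_null_def by blast
  obtain p where p: "continuous_seminorm p" "{x. p x < 1} \<subseteq> U"
    using continuous_seminorm_in_nbhd[OF U(1)] .
  have "\<forall>\<^sub>F n in sequentially. S n ` V \<subseteq> smul (of_real \<epsilon>) ` V"
    if V: "V \<in> dominating_base p" and \<epsilon>: "0 < \<epsilon>" for V and \<epsilon> :: real
  proof -
    obtain q where q: "dominating_seminorm p q" "V = {x. q x < 1}"
      using V unfolding dominating_base_def by blast
    then have cq: "continuous_seminorm q"
      by (simp add: dominating_seminorm_def)
    interpret q: complex_seminorm smul q
      using cq by (rule continuous_seminormD)
    obtain L where L: "0 \<le> L" "\<And>x. p x \<le> L * q x"
      using dominating_seminormE[OF q(1)] by blast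
    define e where "e = \<epsilon> / (L + 1)"
    have e: "0 < e" "e * L < \<epsilon>"
      using \<epsilon> L(1) by (auto simp: e_def field_simps)
    have "\<forall>\<^sub>F n in sequentially. \<forall>x\<in>U. q (S n x) < e"
      using U(2) cq e(1) unfolding uniformly_null_on_iff by blast
    then show ?thesis
    proof eventually_elim
      case (elim n)
      have "q (S n x) < \<epsilon>" if "q x < 1" for x
      proof -
        have "q (S n x) \<le> e * p x"
          by (rule seminorm_le_if_bounded_on_ball[OF _ _ assms(1)])
            (use p cq elim in \<open>auto intro: continuous_seminormD less_imp_le\<close>)
        also have "\<dots> \<le> e * (L * 1)"
          using that L(1) e(1) by (intro mult_left_mono order_trans[OF L(2)]) auto
        also have "\<dots> < \<epsilon>"
          using e(2) by simp
        finally show ?thesis .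
      qed
      then show ?case
        unfolding q(2) using \<epsilon> by (subst q.scaled_ball) auto
    qed
  qed
  then show ?thesis
    using zero_base_dominating[OF p(1)] unfolding nn_null_def by blast
qed

text \<open>One base member \<open>U\<close> inside \<open>V\<close> serves as the neighborhood for
  all \<open>\<epsilon>\<close>.\<close>

lemma equicontinuously_null_if_nn_null:
  assumes "nn_null smul S"
  shows "equicontinuously_null smul S"
  unfolding equicontinuously_null_def
proof (intro allI impI)
  fix V :: "'a set" assume "zero_nbhd V"
  obtain N where N: "zero_base smul N" and
    null: "\<And>U \<epsilon>::real. U \<in> N \<Longrightarrow> \<epsilon> > 0 \<Longrightarrow> \<forall>\<^sub>F n in sequentially. S n ` U \<subseteq> smul (of_real \<epsilon>) ` U"
    using assms unfolding nn_null_def by blast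
  obtain U where U: "U \<in> N" "U \<subseteq> V" "zero_nbhd U"
    using N \<open>zero_nbhd V\<close> unfolding zero_base_def by meson
  have "\<forall>\<^sub>F n in sequentially. S n ` U \<subseteq> smul (of_real \<epsilon>) ` V" if "0 < \<epsilon>" for \<epsilon> :: real
    using null[OF U(1) that] by (rule eventually_mono) (use U(2) in blast)
  then show "\<exists>U. zero_nbhd U \<and>
      (\<forall>\<epsilon>::real. \<epsilon> > 0 \<longrightarrow> (\<forall>\<^sub>F n in sequentially. S n ` U \<subseteq> smul (of_real \<epsilon>) ` V))"
    using U(3) by blast
qed

text \<open>A bounded set lies in some \<open>c U\<close>, and the choice
  \<open>\<epsilon> = 1 / c\<close> cancels \<open>c\<close>.\<close>

lemma bb_null_if_equicontinuously_null:
  assumes "\<And>n. Vector_Spaces.linear smul smul (S n)" "equicontinuously_null smul S"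
  shows "bb_null smul S"
  unfolding bb_null_def uniformly_null_on_def
proof (intro allI impI)
  fix B V :: "'a set" assume B: "tvs_bounded smul B" and V: "zero_nbhd V"
  obtain U where U: "zero_nbhd U"
    "\<And>\<epsilon>::real. \<epsilon> > 0 \<Longrightarrow> \<forall>\<^sub>F n in sequentially. S n ` U \<subseteq> smul (of_real \<epsilon>) ` V"
    using assms(2) V unfolding equicontinuously_null_def by blast
  obtain c :: real where c: "0 < c" "B \<subseteq> smul (of_real c) ` U"
    using B U(1) unfolding tvs_bounded_def by blast
  have "\<forall>\<^sub>F n in sequentially. S n ` U \<subseteq> smul (of_real (1 / c)) ` V"
    using c(1) by (intro U(2)) simp
  then show "\<forall>\<^sub>F n in sequentially. S n ` B \<subseteq> V"
  proof eventually_elim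
    case (elim n)
    interpret Sn: Vector_Spaces.linear smul smul "S n" by (rule assms(1))
    show ?case
    proof
      fix y assume "y \<in> S n ` B"
      then obtain u where u: "u \<in> U" "y = S n (smul (of_real c) u)"
        using c(2) by blast
      then obtain v where "v \<in> V" "S n u = smul (of_real (1 / c)) v"
        using elim by blast
      then show "y \<in> V"
        using u(2) c(1) by (simp add: Sn.scale)
    qed
  qed
qed

definition normalized_power :: "('a \<Rightarrow> 'a) \<Rightarrow> real \<Rightarrow> nat \<Rightarrow> 'a \<Rightarrow> 'a" where
  "normalized_power T \<nu> n x = smul (of_real (1 / \<nu> ^ n)) ((T ^^ n) x)"

lemma linear_normalized_power:
  assumes "Vector_Spaces.linear smul smul T"
  shows "Vector_Spaces.linear smul smul (normalized_power T \<nu> n)"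
  unfolding normalized_power_def by (intro linear_scaled linear_funpow assms)

text \<open>One application of \<open>T\<close> turns the neighborhood \<open>U\<close> into a
  bounded set, so convergence on bounded sets, delayed by one power, is uniform on
  \<open>U\<close>.\<close>

lemma nb_null_powers_if_bb_null:
  assumes "Vector_Spaces.linear smul smul T" "nb_bounded smul T" "\<nu> > 0"
    and null: "bb_null smul (normalized_power T \<nu>)"
  shows "nb_null (normalized_power T \<nu>)"
proof -
  obtain U where U: "zero_nbhd U" "tvs_bounded smul (T ` U)"
    using assms(2) unfolding nb_bounded_def by blast
  have "uniformly_null_on U (normalized_power T \<nu>)"
    unfolding uniformly_null_on_iff
  proof (intro allI impI)
    fix q and e :: real assume q: "continuous_seminorm q" and "0 < e"
    interpret q: complex_seminorm smul q
      using q by (rule continuous_seminormD)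
    \<comment> \<open>The factor \<open>\<nu>\<close> pays for the additional division in passing
      from \<open>n\<close> to \<open>Suc n\<close>.\<close>
    have "0 < e * \<nu>"
      using \<open>0 < e\<close> \<open>\<nu> > 0\<close> by simp
    then have "\<forall>\<^sub>F n in sequentially. \<forall>x\<in>T ` U. q (normalized_power T \<nu> n x) < e * \<nu>"
      using null U(2) q unfolding bb_null_def uniformly_null_on_iff by blast
    then have "\<forall>\<^sub>F n in sequentially. \<forall>x\<in>U. q (normalized_power T \<nu> (Suc n) x) < e"
    proof eventually_elim
      case (elim n)
      show ?case
      proof
        fix x assume "x \<in> U"
        then have "q (normalized_power T \<nu> n (T x)) < e * \<nu>"
          using elim by blast
        moreover have "normalized_power T \<nu> (Suc n) x =
            smul (of_real (1 / \<nu>)) (normalized_power T \<nu> n (T x))"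
          by (simp add: normalized_power_def funpow_swap1)
        ultimately show "q (normalized_power T \<nu> (Suc n) x) < e"
          using \<open>\<nu> > 0\<close> by (simp add: q.homogeneous norm_divide field_simps)
      qed
    qed
    then show "\<forall>\<^sub>F n in sequentially. \<forall>x\<in>U. q (normalized_power T \<nu> n x) < e"
      by (subst (asm) eventually_sequentially_Suc)
  qed
  then show ?thesis
    using U(1) unfolding nb_null_def by blast
qed

text \<open>The radii are compared in a cycle; the link from bb back to nb rests on nb-boundedness
  of \<open>T\<close>.\<close>

lemma radius_eq:
  assumes "Vector_Spaces.linear smul smul T" "nb_bounded smul T"
    and "r \<in> {radius_bb smul T, radius_c smul T, radius_nn smul T, radius_nb smul T}"
  shows "r = radius_nb smul T"
proof -
  note linear = linear_normalized_power[OF assms(1)]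
  have "radius_nn smul T \<le> radius_nb smul T"
    unfolding radius_nn_def radius_nb_def
    by (rule radius_wrt_antimono)
      (use nn_null_if_nb_null[OF linear] in \<open>simp add: normalized_power_def[abs_def]\<close>)
  moreover have "radius_c smul T \<le> radius_nn smul T"
    unfolding radius_nn_def radius_c_def
    by (rule radius_wrt_antimono) (rule equicontinuously_null_if_nn_null)
  moreover have "radius_bb smul T \<le> radius_c smul T"
    unfolding radius_bb_def radius_c_def
    by (rule radius_wrt_antimono)
      (use bb_null_if_equicontinuously_null[OF linear] in \<open>simp add: normalized_power_def[abs_def]\<close>)
  moreover have "radius_nb smul T \<le> radius_bb smul T"
    unfolding radius_bb_def radius_nb_def
    by (rule radius_wrt_antimono)
      (use nb_null_powers_if_bb_null[OF assms(1,2)] in \<open>simp add: normalized_power_def[abs_def]\<close>)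
  ultimately show ?thesis
    using assms(3) by auto
qed

text \<open>Substituting \<open>z = 1 / \<mu>\<close> turns the region
  \<open>m \<le> cmod \<mu>\<close> into the punctured disc of radius \<open>1 / m\<close>, on which
  \<open>1 - z T\<close> has the inverse \<open>(1 / z) R (1 / z)\<close>. The point
  \<open>1 / \<nu>\<close> lies strictly inside, so the powers decay there.\<close>

lemma nb_null_powers_if_resolvent:
  assumes T: "Vector_Spaces.linear smul smul T" "nb_bounded smul T"
    and "0 < m" "m < \<nu>"
    and resolvent: "\<And>\<mu>. m \<le> cmod \<mu> \<Longrightarrow> \<mu> \<in> resolvent_set smul (bb_bounded smul) T"
  shows "nb_null (normalized_power T \<nu>)"
proof -
  interpret T: Vector_Spaces.linear smul smul T by fact
  obtain p where p: "continuous_seminorm p"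
    "\<And>q. continuous_seminorm q \<Longrightarrow> \<exists>K. \<forall>x. q (T x) \<le> K * p x"
    using T nb_bounded_iff by blast
  obtain a where a: "\<And>x. p (T x) \<le> a * p x"
    using p by blast
  interpret p: complex_seminorm smul p
    using p(1) by (rule continuous_seminormD)
  obtain R where R: "\<And>\<mu>. m \<le> cmod \<mu> \<Longrightarrow> Vector_Spaces.linear smul smul (R \<mu>)"
    "\<And>\<mu>. m \<le> cmod \<mu> \<Longrightarrow> bb_bounded smul (R \<mu>)"
    "\<And>\<mu>. m \<le> cmod \<mu> \<Longrightarrow> R \<mu> \<circ> (\<lambda>x. smul \<mu> x - T x) = id"
    "\<And>\<mu>. m \<le> cmod \<mu> \<Longrightarrow> (\<lambda>x. smul \<mu> x - T x) \<circ> R \<mu> = id"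
    using resolvent unfolding resolvent_set_def mem_Collect_eq by metis
  \<comment> \<open>At \<open>z = 0\<close> the inverse of \<open>1 - z T\<close> is the identity,
    which the formula in \<open>1 / z\<close> misses.\<close>
  define A where "A z = (if z = 0 then id else (\<lambda>x. smul (1 / z) (R (1 / z) x)))" for z
  interpret bounded_resolvent smul p T A a "1 / m"
  proof (intro bounded_resolvent.intro bounded_resolvent_axioms.intro
      p.complex_seminorm_axioms T(1))
    show "p (T x) \<le> a * p x" for x
      by (rule a)
    show "0 < 1 / m"
      using \<open>0 < m\<close> by simp
    fix z :: complex assume z: "cmod z \<le> 1 / m"
    have m: "m \<le> cmod (1 / z)" if "z \<noteq> 0"
      using z that \<open>0 < m\<close> by (simp add: norm_divide field_simps)
    show "Vector_Spaces.linear smul smul (A z)"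
      using linear_scaled[OF R(1)[OF m]] linear_id by (auto simp: A_def)
    show "A z (x - smul z (T x)) = x" for x
    proof (cases "z = 0")
      case False
      interpret Rz: Vector_Spaces.linear smul smul "R (1 / z)"
        by (rule R(1)[OF m[OF False]])
      have "A z (x - smul z (T x)) = R (1 / z) (smul (1 / z) x - T x)"
        using False by (simp add: A_def Rz.scale[symmetric] scale_right_diff_distrib)
      then show ?thesis
        using fun_cong[OF R(3)[OF m[OF False]], of x] by simp
    qed (simp add: A_def)
    show "A z x - smul z (T (A z x)) = x" for x
    proof (cases "z = 0")
      case False
      then have "A z x - smul z (T (A z x)) = smul (1 / z) (R (1 / z) x) - T (R (1 / z) x)"
        by (simp add: A_def T.scale)
      then show ?thesis
        using fun_cong[OF R(4)[OF m[OF False]], of x] by simp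
    qed (simp add: A_def)
    show "\<exists>K. \<forall>x. p (A z x) \<le> K * p x"
    proof (cases "z = 0")
      case True
      then show ?thesis
        by (auto simp: A_def intro: exI[of _ 1])
    next
      case False
      interpret Rz: Vector_Spaces.linear smul smul "R (1 / z)"
        by (rule R(1)[OF m[OF False]])
      \<comment> \<open>\<open>R (1 / z)\<close> is only known to preserve bounded sets, but
        \<open>T\<close> maps the unit ball of \<open>p\<close> to a bounded set. So
        \<open>R (1 / z) T\<close> is bounded for \<open>p\<close>, and
        \<open>A z = 1 + R (1 / z) T\<close>.\<close>
      have RT: "Vector_Spaces.linear smul smul (\<lambda>x. R (1 / z) (T x))"
        by (rule linear_comp[OF R(1)[OF m[OF False]] T(1)])
      have "tvs_bounded smul (T ` {x. p x < 1})"
        by (rule tvs_bounded_image_ball[OF p])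
      then have "tvs_bounded smul (R (1 / z) ` T ` {x. p x < 1})"
        using R(2)[OF m[OF False]] unfolding bb_bounded_def by blast
      then obtain K where "\<forall>x\<in>R (1 / z) ` T ` {x. p x < 1}. p x \<le> K"
        using p(1) unfolding tvs_bounded_iff by blast
      then have K: "p (R (1 / z) (T x)) \<le> K * p x" for x
        by (intro seminorm_le_if_bounded_on_ball[OF p.complex_seminorm_axioms p.complex_seminorm_axioms RT])
          auto
      have "p (A z x) \<le> (1 + K) * p x" for x
      proof -
        have "A z x = x + R (1 / z) (T x)"
          using fun_cong[OF R(3)[OF m[OF False]], of x] False
          by (simp add: A_def Rz.diff Rz.scale algebra_simps)
        then show ?thesis
          using p.triangle[of x "R (1 / z) (T x)"] K[of x] by (simp add: algebra_simps)
      qed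
      then show ?thesis by blast
    qed
  qed
  have "0 < \<nu>"
    using \<open>0 < m\<close> \<open>m < \<nu>\<close> by simp
  then have null: "powers_null (1 / \<nu>)"
    using \<open>0 < m\<close> \<open>m < \<nu>\<close> by (intro powers_null_below_radius) (simp_all add: frac_less2)
  have "uniformly_null_on {x. p x < 1} (normalized_power T \<nu>)"
    unfolding uniformly_null_on_iff
  proof (intro allI impI)
    fix q and e :: real assume q: "continuous_seminorm q" and "0 < e"
    interpret q: complex_seminorm smul q
      using q by (rule continuous_seminormD)
    obtain K where K: "\<And>x. q (T x) \<le> K * p x"
      using p(2) q by blast
    \<comment> \<open>\<open>\<bar>K\<bar>\<close> is the price of replacing \<open>q\<close> by
      \<open>p\<close>, and \<open>\<nu>\<close> compensates the extra power in
      \<open>Suc n\<close>.\<close>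
    define d where "d = e * \<nu> / (\<bar>K\<bar> + 1)"
    have d: "0 < d" "\<bar>K\<bar> * d < e * \<nu>"
      using \<open>0 < e\<close> \<open>0 < \<nu>\<close> by (auto simp: d_def field_simps add_pos_nonneg)
    have "\<forall>\<^sub>F n in sequentially. \<forall>x. (1 / \<nu>) ^ n * p ((T ^^ n) x) \<le> d * p x"
      using null d(1) unfolding powers_null_def by blast
    then have "\<forall>\<^sub>F n in sequentially. \<forall>x\<in>{x. p x < 1}. q (normalized_power T \<nu> (Suc n) x) < e"
    proof eventually_elim
      case (elim n)
      show ?case
      proof
        fix x assume "x \<in> {x. p x < 1}"
        then have "(1 / \<nu>) ^ n * p ((T ^^ n) x) \<le> d * 1"
          using d(1) by (intro order_trans[OF spec[OF elim]] mult_left_mono) auto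
        \<comment> \<open>One factor \<open>T\<close> of the power \<open>Suc n\<close> is spent on
          passing from \<open>q\<close> to \<open>p\<close>.\<close>
        have "\<nu> * q (normalized_power T \<nu> (Suc n) x) = (1 / \<nu>) ^ n * q (T ((T ^^ n) x))"
          using \<open>0 < \<nu>\<close>
          by (simp add: normalized_power_def q.homogeneous norm_divide norm_mult norm_power power_divide)
        also have "\<dots> \<le> (1 / \<nu>) ^ n * (\<bar>K\<bar> * p ((T ^^ n) x))"
          using \<open>0 < \<nu>\<close> by (intro mult_left_mono order_trans[OF K] mult_right_mono) auto
        also have "\<dots> = \<bar>K\<bar> * ((1 / \<nu>) ^ n * p ((T ^^ n) x))"
          by simp
        also have "\<dots> \<le> \<bar>K\<bar> * (d * 1)"
          by (intro mult_left_mono) (fact, simp)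
        also have "\<dots> < \<nu> * e"
          using d(2) by (simp add: mult.commute)
        finally show "q (normalized_power T \<nu> (Suc n) x) < e"
          using \<open>0 < \<nu>\<close> by simp
      qed
    qed
    then show "\<forall>\<^sub>F n in sequentially. \<forall>x\<in>{x. p x < 1}. q (normalized_power T \<nu> n x) < e"
      by (subst (asm) eventually_sequentially_Suc)
  qed
  then show ?thesis
    using p(1) unfolding nb_null_def continuous_seminorm_def by blast
qed

end

section \<open>The Neumann series and the spectral radius\<close>

context complex_lcs
begin

lemma tendsto_zero_if_seminorms:
  assumes "\<And>q. continuous_seminorm q \<Longrightarrow> ((\<lambda>n. q (X n)) \<longlongrightarrow> 0) F"
  shows "(X \<longlongrightarrow> 0) F"
  unfolding filterlim_iff
proof (intro allI impI)
  fix P :: "'a \<Rightarrow> bool" assume "eventually P (nhds 0)"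
  then have "zero_nbhd (Collect P)"
    by (simp add: zero_nbhd_def)
  then obtain q where q: "continuous_seminorm q" "{x. q x < 1} \<subseteq> Collect P"
    using continuous_seminorm_in_nbhd by blast
  have "eventually (\<lambda>n. q (X n) < 1) F"
    using assms[OF q(1)] by (rule order_tendstoD) simp
  then show "eventually (\<lambda>n. P (X n)) F"
    by (rule eventually_mono) (use q(2) in blast)
qed

lemma tendsto_seminorm_diff:
  assumes "(X \<longlongrightarrow> x) F" "continuous_seminorm q" "0 < e"
  shows "eventually (\<lambda>n. q (x - X n) < e) F"
proof -
  have "((\<lambda>n. x - X n) \<longlongrightarrow> x - x) F"
    by (intro tendsto_intros assms)
  moreover have "eventually (\<lambda>x. q x < e) (nhds 0)"
    using zero_nbhd_ball[OF assms(2,3)] by (simp add: zero_nbhd_def)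
  ultimately show ?thesis
    by (auto dest: eventually_compose_filterlim)
qed

end

section \<open>Series in sequentially complete spaces and the resolvent\<close>

context seq_complete_lcs
begin

text \<open>The threshold \<open>1\<close> is no restriction, as positive multiples of continuous
  seminorms are again continuous seminorms.\<close>

lemma convergent_if_seminorm_Cauchy:
  assumes "\<And>q. continuous_seminorm q \<Longrightarrow> \<exists>N. \<forall>m\<ge>N. \<forall>n\<ge>N. q (X m - X n) < 1"
  shows "convergent X"
proof (rule seq_complete)
  show "Cauchy X"
    unfolding Cauchy_uniform_iff
  proof (intro allI impI)
    fix P :: "'a \<times> 'a \<Rightarrow> bool" assume "eventually P uniformity"
    \<comment> \<open>The uniformity is the pullback of the neighborhood filter of zero under the
      difference map.\<close>
    then obtain Q where Q: "eventually Q (nhds 0)" "\<And>x y. Q (y - x) \<Longrightarrow> P (x, y)"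
      unfolding cauchy_seq_finset_iff_vanishing by (auto simp: eventually_filtercomap)
    have "zero_nbhd (Collect Q)"
      using Q(1) by (simp add: zero_nbhd_def)
    then obtain q where q: "continuous_seminorm q" "{x. q x < 1} \<subseteq> Collect Q"
      using continuous_seminorm_in_nbhd by blast
    then obtain N where "\<forall>m\<ge>N. \<forall>n\<ge>N. q (X m - X n) < 1"
      using assms by blast
    then show "\<exists>N. \<forall>n\<ge>N. \<forall>m\<ge>N. P (X n, X m)"
      using q(2) Q(2) by blast
  qed
qed

text \<open>The comparison test, with a majorant that may depend on the seminorm: blocks of the
  series are bounded by blocks of \<open>g\<close>.\<close>

lemma convergent_series:
  assumes "\<And>q. continuous_seminorm q \<Longrightarrow> \<exists>g. summable g \<and> (\<forall>k. q (f k) \<le> g k)"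
  shows "convergent (\<lambda>n. \<Sum>k<n. f k)"
proof (rule convergent_if_seminorm_Cauchy)
  fix q assume q: "continuous_seminorm q"
  interpret q: complex_seminorm smul q
    using q by (rule continuous_seminormD)
  obtain g where g: "summable g" "\<And>k. q (f k) \<le> g k"
    using assms[OF q] by blast
  then obtain N where N: "\<And>m n. m \<ge> N \<Longrightarrow> norm (sum g {m..<n}) < 1"
    unfolding summable_Cauchy using zero_less_one by blast
  have *: "q ((\<Sum>k<n. f k) - (\<Sum>k<m. f k)) < 1" if "N \<le> m" "m \<le> n" for m n
  proof -
    have "(\<Sum>k<n. f k) - (\<Sum>k<m. f k) = sum f {m..<n}"
      using that sum_diff_nat_ivl[of 0 m n f] by (simp add: atLeast0LessThan)
    then have "q ((\<Sum>k<n. f k) - (\<Sum>k<m. f k)) \<le> (\<Sum>k\<in>{m..<n}. q (f k))"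
      by (simp add: q.sum_le)
    also have "\<dots> \<le> sum g {m..<n}"
      by (intro sum_mono g)
    also have "\<dots> < 1"
      using N[OF that(1), of n] by simp
    finally show ?thesis .
  qed
  have "q ((\<Sum>k<m. f k) - (\<Sum>k<n. f k)) < 1" if "N \<le> m" "N \<le> n" for m n
  proof (cases "m \<le> n")
    case True
    then show ?thesis
      using *[OF that(1) True] q.at_minus[of "(\<Sum>k<m. f k) - (\<Sum>k<n. f k)"] by simp
  qed (use * that in simp)
  then show "\<exists>N. \<forall>m\<ge>N. \<forall>n\<ge>N. q ((\<Sum>k<m. f k) - (\<Sum>k<n. f k)) < 1"
    by blast
qed

text \<open>The inverse is the Neumann series with terms \<open>f k\<close>. They are the normalized
  powers, bounded on bounded sets, times geometric factors of ratio
  \<open>\<nu> / cmod \<mu> < 1\<close> in modulus.\<close>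

lemma resolvent_if_bb_null_powers:
  assumes linear: "Vector_Spaces.linear smul smul T" and cont: "continuous_on UNIV T"
    and "0 < \<nu>" "\<nu> < cmod \<mu>" and null: "bb_null smul (normalized_power T \<nu>)"
  shows "\<mu> \<in> resolvent_set smul (bb_bounded smul) T"
proof -
  interpret T: Vector_Spaces.linear smul smul T by fact
  have "\<mu> \<noteq> 0"
    using assms(3,4) by auto
  define f where "f k x = smul (1 / \<mu> ^ Suc k) ((T ^^ k) x)" for k x
  have cont_funpow: "continuous_on UNIV (T ^^ k)" for k
    by (induction k) (auto intro: continuous_on_compose2[OF cont] simp: o_def)
  \<comment> \<open>The majorant is uniform over \<open>B\<close>: singletons yield pointwise
    convergence, general \<open>B\<close> the bb-boundedness of the sum.\<close>
  have majorant: "\<exists>g. summable g \<and> (\<forall>k. \<forall>x\<in>B. q (f k x) \<le> g k)"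
    if B: "tvs_bounded smul B" and q: "continuous_seminorm q" for B q
  proof -
    interpret q: complex_seminorm smul q
      using q by (rule continuous_seminormD)
    have "\<forall>\<^sub>F k in sequentially. \<forall>x\<in>B. q (normalized_power T \<nu> k x) < 1"
      using null B q unfolding bb_null_def uniformly_null_on_iff by simp
    then obtain N where N: "\<And>k x. k \<ge> N \<Longrightarrow> x \<in> B \<Longrightarrow> q (normalized_power T \<nu> k x) < 1"
      unfolding eventually_sequentially by blast
    \<comment> \<open>The null condition controls only \<open>k \<ge> N\<close>; the finitely many
      earlier powers are bounded on \<open>B\<close> by continuity.\<close>
    have "\<exists>K. \<forall>x\<in>B. q (normalized_power T \<nu> k x) \<le> K" for k
    proof -
      have "continuous_on UNIV (normalized_power T \<nu> k)"
        unfolding normalized_power_def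
        by (rule continuous_on_compose2[OF continuous_on_smul_left cont_funpow]) simp
      then have "tvs_bounded smul (normalized_power T \<nu> k ` B)"
        using bb_bounded_if_continuous[OF linear_normalized_power[OF linear]] B
        unfolding bb_bounded_def by blast
      then show ?thesis
        using q unfolding tvs_bounded_iff by blast
    qed
    then obtain K where K: "\<And>k x. x \<in> B \<Longrightarrow> q (normalized_power T \<nu> k x) \<le> K k"
      by metis
    define C where "C = 1 + (\<Sum>k<N. \<bar>K k\<bar>)"
    have C: "q (normalized_power T \<nu> k x) \<le> C" if "x \<in> B" for k x
    proof (cases "k < N")
      case True
      then have "\<bar>K k\<bar> \<le> (\<Sum>k<N. \<bar>K k\<bar>)"
        by (intro member_le_sum) auto
      then show ?thesis
        using K[OF that, of k] by (simp add: C_def)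
    next
      case False
      then have "q (normalized_power T \<nu> k x) < 1"
        using N that by simp
      moreover have "0 \<le> (\<Sum>k<N. \<bar>K k\<bar>)"
        by (simp add: sum_nonneg)
      ultimately show ?thesis
        unfolding C_def by linarith
    qed
    define g where "g k = C / cmod \<mu> * (\<nu> / cmod \<mu>) ^ k" for k
    have "summable g"
      unfolding g_def using assms(3,4) \<open>\<mu> \<noteq> 0\<close>
      by (intro summable_mult summable_geometric) (simp add: divide_less_eq)
    moreover have "q (f k x) \<le> g k" if "x \<in> B" for k x
    proof -
      have "f k x = smul (of_real (\<nu> ^ k) / \<mu> ^ Suc k) (normalized_power T \<nu> k x)"
        using assms(3) by (simp add: f_def normalized_power_def)
      then have "q (f k x) = \<nu> ^ k / cmod \<mu> ^ Suc k * q (normalized_power T \<nu> k x)"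
        using assms(3) by (simp add: q.homogeneous norm_divide norm_mult norm_power)
      also have "\<dots> \<le> \<nu> ^ k / cmod \<mu> ^ Suc k * C"
        using assms(3) C[OF that] by (intro mult_left_mono) auto
      also have "\<dots> = g k"
        by (simp add: g_def power_divide)
      finally show ?thesis .
    qed
    ultimately show ?thesis by blast
  qed
  have bounded_singleton: "tvs_bounded smul {x}" for x
    unfolding tvs_bounded_iff by auto
  have "convergent (\<lambda>n. \<Sum>k<n. f k x)" for x
  proof (rule convergent_series)
    show "\<exists>g. summable g \<and> (\<forall>k. q (f k x) \<le> g k)" if "continuous_seminorm q" for q
      using majorant[OF bounded_singleton[of x] that] by simp
  qed
  then obtain R where R: "(\<lambda>n. \<Sum>k<n. f k x) \<longlonglongrightarrow> R x" for x
    unfolding convergent_def by metis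
  have f_add: "f k (x + y) = f k x + f k y" and f_smul: "f k (smul c x) = smul c (f k x)" for k x y c
  proof -
    interpret Tk: Vector_Spaces.linear smul smul "T ^^ k"
      by (rule linear_funpow) fact
    show "f k (x + y) = f k x + f k y" "f k (smul c x) = smul c (f k x)"
      by (simp_all add: f_def Tk.add Tk.scale scale_right_distrib mult.commute)
  qed
  have "R (x + y) = R x + R y" for x y
    using LIMSEQ_unique[OF R[of "x + y"]] tendsto_add[OF R[of x] R[of y]]
    by (simp add: f_add sum.distrib)
  moreover have "R (smul c x) = smul c (R x)" for c x
  proof -
    have "(\<lambda>n. smul c (\<Sum>k<n. f k x)) \<longlonglongrightarrow> smul c (R x)"
      by (rule continuous_on_tendsto_compose[OF continuous_on_smul_left R]) auto
    then show ?thesis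
      using LIMSEQ_unique[OF R[of "smul c x"]] by (simp add: f_smul scale_sum_right)
  qed
  ultimately have linear_R: "Vector_Spaces.linear smul smul R"
    by (simp add: linear_iff_same_space[OF vector_space_axioms])
  interpret R: Vector_Spaces.linear smul smul R by (fact linear_R)
  have left: "R (smul \<mu> x - T x) = x" for x
  proof -
    \<comment> \<open>The telescoped partial sums leave the remainder
      \<open>smul \<mu> (f n x)\<close>, so the terms have to tend to zero.\<close>
    have "(\<lambda>n. f n x) \<longlonglongrightarrow> 0"
    proof (rule tendsto_zero_if_seminorms)
      fix q assume q: "continuous_seminorm q"
      interpret q: complex_seminorm smul q
        using q by (rule continuous_seminormD)
      obtain g where g: "summable g" "\<And>k. q (f k x) \<le> g k"
        using majorant[OF bounded_singleton[of x] q] by auto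
      then show "(\<lambda>n. q (f n x)) \<longlonglongrightarrow> 0"
        by (intro tendsto_sandwich[OF _ _ tendsto_const summable_LIMSEQ_zero[OF g(1)]]) auto
    qed
    then have "(\<lambda>n. smul \<mu> (f n x)) \<longlonglongrightarrow> smul \<mu> 0"
      by (rule continuous_on_tendsto_compose[OF continuous_on_smul_left]) auto
    then have "(\<lambda>n. x - smul \<mu> (f n x)) \<longlonglongrightarrow> x - smul \<mu> 0"
      by (intro tendsto_intros)
    moreover have "(\<Sum>k<n. f k (smul \<mu> x - T x)) = x - smul \<mu> (f n x)" for n
    proof (induction n)
      case 0
      then show ?case
        using \<open>\<mu> \<noteq> 0\<close> by (simp add: f_def)
    next
      case (Suc n)
      interpret Tn: Vector_Spaces.linear smul smul "T ^^ n"
        by (rule linear_funpow) fact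
      have "f n (smul \<mu> x - T x) = smul \<mu> (f n x) - smul \<mu> (f (Suc n) x)"
        using \<open>\<mu> \<noteq> 0\<close>
        by (simp add: f_def Tn.diff Tn.scale scale_right_diff_distrib funpow_swap1)
      then show ?case
        using Suc by simp
    qed
    ultimately show ?thesis
      using LIMSEQ_unique[OF R[of "smul \<mu> x - T x"]] by simp
  qed
  \<comment> \<open>Once \<open>R\<close> commutes with \<open>T\<close>, the left inverse is a
    right inverse too. Continuity lets \<open>T\<close> pass through the limit.\<close>
  have commute: "R (T x) = T (R x)" for x
  proof -
    have "(\<lambda>n. T (\<Sum>k<n. f k x)) \<longlonglongrightarrow> T (R x)"
      by (rule continuous_on_tendsto_compose[OF cont R]) auto
    moreover have "T (f k x) = f k (T x)" for k
      by (simp add: f_def T.scale funpow_swap1)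
    ultimately show ?thesis
      using LIMSEQ_unique[OF R[of "T x"]] by (simp add: T.sum)
  qed
  have right: "smul \<mu> (R x) - T (R x) = x" for x
    using left[of x] by (simp add: R.diff R.scale commute)
  have "bb_bounded smul R"
    unfolding bb_bounded_def
  proof (intro allI impI)
    fix B assume B: "tvs_bounded smul B"
    show "tvs_bounded smul (R ` B)"
      unfolding tvs_bounded_iff
    proof (intro allI impI)
      fix q assume q: "continuous_seminorm q"
      interpret q: complex_seminorm smul q
        using q by (rule continuous_seminormD)
      obtain g where g: "summable g" "\<And>k x. x \<in> B \<Longrightarrow> q (f k x) \<le> g k"
        using majorant[OF B q] by blast
      \<comment> \<open>The added \<open>1\<close> covers the distance from \<open>R x\<close> to a
        partial sum, whose length may depend on \<open>x\<close>.\<close>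
      have "q (R x) \<le> suminf g + 1" if "x \<in> B" for x
      proof -
        obtain n where "q (R x - (\<Sum>k<n. f k x)) < 1"
          using eventually_happens'[OF _ tendsto_seminorm_diff[OF R q zero_less_one]] by auto
        moreover have "q (\<Sum>k<n. f k x) \<le> (\<Sum>k<n. q (f k x))"
          by (rule q.sum_le)
        moreover have "\<dots> \<le> (\<Sum>k<n. g k)"
          using g(2) that by (intro sum_mono) auto
        moreover have "\<dots> \<le> suminf g"
          using order_trans[OF q.nonneg g(2)[OF that]] g(1) by (intro sum_le_suminf) auto
        ultimately show ?thesis
          using q.triangle[of "R x - (\<Sum>k<n. f k x)" "\<Sum>k<n. f k x"] by simp
      qed
      then show "\<exists>K. \<forall>x\<in>R ` B. q x \<le> K"
        by blast
    qed
  qed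
  then show ?thesis
    using linear_R left right unfolding resolvent_set_def by (auto simp: fun_eq_iff)
qed

text \<open>If \<open>\<nu>\<close> is admissible for the radius, the Neumann series excludes
  spectrum beyond \<open>\<nu>\<close>. Conversely, every \<open>\<nu>\<close> above the spectral
  modulus is admissible by the decay of powers.\<close>

lemma spectrum_modulus_eq_radius:
  assumes T: "Vector_Spaces.linear smul smul T" "nb_bounded smul T"
  shows "spectrum_modulus (spectrum_bb smul T) = radius_nb smul T"
proof (rule antisym)
  have "continuous_on UNIV T"
    using nb_bounded_iff continuous_on_iff_seminorms T by blast
  have "radius_nb smul T = radius_bb smul T"
    using radius_eq[OF T, of "radius_bb smul T"] by simp
  moreover have "ennreal (cmod \<mu>) \<le> radius_bb smul T" if \<mu>: "\<mu> \<in> spectrum_bb smul T" for \<mu>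
    unfolding radius_bb_def radius_wrt_def
  proof (rule Inf_greatest)
    fix s assume "s \<in> {ennreal \<nu> |\<nu>. \<nu> > 0 \<and>
      bb_null smul (\<lambda>n x. smul (of_real (1 / \<nu> ^ n)) ((T ^^ n) x))}"
    then obtain \<nu> where \<nu>: "s = ennreal \<nu>" "\<nu> > 0" "bb_null smul (normalized_power T \<nu>)"
      by (auto simp: normalized_power_def[abs_def])
    have "cmod \<mu> \<le> \<nu>"
      using resolvent_if_bb_null_powers[OF T(1) \<open>continuous_on UNIV T\<close> \<nu>(2) _ \<nu>(3)] \<mu>
      unfolding spectrum_bb_def by (meson ComplD not_le)
    then show "ennreal (cmod \<mu>) \<le> s"
      unfolding \<nu>(1) by (rule ennreal_leI)
  qed
  ultimately show "spectrum_modulus (spectrum_bb smul T) \<le> radius_nb smul T"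
    unfolding spectrum_modulus_def by (auto intro: SUP_least)
next
  show "radius_nb smul T \<le> spectrum_modulus (spectrum_bb smul T)"
  proof (rule dense_ge)
    fix y assume less: "spectrum_modulus (spectrum_bb smul T) < y"
    show "radius_nb smul T \<le> y"
    proof (cases y)
      case (real \<nu>)
      \<comment> \<open>The decay result asks for resolvents on a closed region
        \<open>m \<le> cmod \<mu>\<close> with \<open>m < \<nu>\<close>, so an intermediate value is
        inserted.\<close>
      obtain z where z: "spectrum_modulus (spectrum_bb smul T) < z" "z < y"
        using dense[OF less] by blast
      then obtain m where m: "z = ennreal m" "0 \<le> m"
        using real by (cases z) auto
      have "m < \<nu>"
        using z(2) m real by (simp add: ennreal_less_iff)
      have "0 < m"
        using z(1) m by (metis ennreal_0 not_less_zero order_le_less)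
      have "\<mu> \<in> resolvent_set smul (bb_bounded smul) T" if "m \<le> cmod \<mu>" for \<mu>
      proof (rule ccontr)
        assume "\<mu> \<notin> resolvent_set smul (bb_bounded smul) T"
        then have "ennreal (cmod \<mu>) \<le> spectrum_modulus (spectrum_bb smul T)"
          unfolding spectrum_modulus_def spectrum_bb_def by (intro SUP_upper) simp
        then show False
          using z(1) m ennreal_leI[OF that] by (metis leD order_trans)
      qed
      then have "nb_null (normalized_power T \<nu>)"
        using nb_null_powers_if_resolvent[OF T \<open>0 < m\<close> \<open>m < \<nu>\<close>] by blast
      then show ?thesis
        unfolding radius_nb_def radius_wrt_def using real \<open>0 < m\<close> \<open>m < \<nu>\<close>
        by (intro Inf_lower) (auto simp: normalized_power_def[abs_def])
    qed simp
  qed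
qed

end

theorem theorem6p10:
  fixes smul :: "complex \<Rightarrow>
      'a::{uniform_topological_group_add,topological_ab_group_add,t2_space} \<Rightarrow> 'a"
    and T :: "'a \<Rightarrow> 'a"
  assumes "seq_complete_lcs smul"
    and "Vector_Spaces.linear smul smul T"
    and "nb_bounded smul T"
  shows "\<forall>\<sigma> \<in> {spectrum_bb smul T, spectrum_c smul T, spectrum_nn smul T, spectrum_nb smul T}.
         \<forall>r \<in> {radius_bb smul T, radius_c smul T, radius_nn smul T, radius_nb smul T}.
           spectrum_modulus \<sigma> = r"
proof (intro ballI)
  interpret seq_complete_lcs smul by fact
  fix \<sigma> r
  assume "\<sigma> \<in> {spectrum_bb smul T, spectrum_c smul T, spectrum_nn smul T, spectrum_nb smul T}"
    and "r \<in> {radius_bb smul T, radius_c smul T, radius_nn smul T, radius_nb smul T}"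
  \<comment> \<open>Every choice reduces to the pair \<open>spectrum_bb\<close> and
    \<open>radius_nb\<close>.\<close>
  then show "spectrum_modulus \<sigma> = r"
    using spectrum_modulus_eq radius_eq spectrum_modulus_eq_radius assms(2,3) by metis
qed

end
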